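(* $\mathcal{B}_{\aleph_0}\cap\big([\frac{1+\sqrt5}{2},q_f)\setminus\{q_2\}\big)$ is a discrete set.
   Context: For $q\in(1,2)$ and $x\in[0,\frac1{q-1}]$, a $q$-expansion of $x$ is a sequence $(\epsilon_i)_{i=1}^\infty\in\{0,1\}^{\mathbb N}$ with $x=\sum_{i=1}^\infty \epsilon_i q^{-i}$; $\Sigma_q(x)$ denotes the set of all $q$-expansions of $x$. Define $$\mathcal{B}_{\aleph_0}:=\Big\{q\in(1,2) : \text{there exists } x\in\big(0,\tfrac1{q-1}\big) \text{ with } \operatorname{card}\Sigma_q(x)=\aleph_0\Big\}.$$ The number $q_2\approx1.71064$ is the root in $(1,2)$ of $x^4=2x^2+x+1$, and $q_f\approx1.75488$ is the root in $(1,2)$ of $x^3=2x^2-x+1$. A set $A\subset\mathbb R$ is discrete if every $q^*\in A$ is contained in an open interval $I_{q^*}$ with $(I_{q^*}\setminus\{q^*\})\cap A=\emptyset$. *)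

theory Defs
  imports "HOL-Analysis.Analysis" "HOL-Library.Equipollence"
begin

text \<open>
  Expansions are indexed from 0, so that \<open>\<epsilon> i\<close> is the digit belonging to \<open>q ^ -(i + 1)\<close>.
\<close>

definition q_expansions :: "real \<Rightarrow> real \<Rightarrow> (nat \<Rightarrow> nat) set" where
  "q_expansions q x =
     {\<epsilon>. range \<epsilon> \<subseteq> {0, 1} \<and> (\<lambda>i. real (\<epsilon> i) / q ^ Suc i) sums x}"

definition B_aleph0 :: "real set" where
  "B_aleph0 = {q \<in> {1<..<2}. \<exists>x \<in> {0<..<1 / (q - 1)}. q_expansions q x \<approx> (UNIV :: nat set)}"

definition q2 :: real where
  "q2 = (THE q. q \<in> {1<..<2} \<and> q ^ 4 = 2 * q ^ 2 + q + 1)"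

definition qf :: real where
  "qf = (THE q. q \<in> {1<..<2} \<and> q ^ 3 = 2 * q ^ 2 - q + 1)"

text \<open>The definite descriptions are meaningful: each root exists and is unique.\<close>

lemma q2_unique:
  fixes x y :: real
  assumes x: "x \<in> {1<..<2}" "x ^ 4 = 2 * x ^ 2 + x + 1"
    and y: "y \<in> {1<..<2}" "y ^ 4 = 2 * y ^ 2 + y + 1"
  shows "x = y"
proof (rule ccontr)
  assume ne: "x \<noteq> y"
  have sq: "z ^ 2 > 2" if "z \<in> {1<..<2}" "z ^ 4 = 2 * z ^ 2 + z + 1" for z :: real
  proof -
    have "z ^ 2 * (z ^ 2 - 2) = z + 1" using that by algebra
    then have "z ^ 2 * (z ^ 2 - 2) > 0" using that by simp
    then show ?thesis using that by (simp add: zero_less_mult_iff)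
  qed
  have "(x - y) * ((x + y) * (x ^ 2 + y ^ 2 - 2) - 1) = 0" using x(2) y(2) by algebra
  then have "(x + y) * (x ^ 2 + y ^ 2 - 2) = 1" using ne by simp
  moreover have "2 * 2 \<le> (x + y) * (x ^ 2 + y ^ 2 - 2)"
    using sq[OF x] sq[OF y] x(1) y(1) by (intro mult_mono) auto
  ultimately show False by simp
qed

lemma qf_unique:
  fixes x y :: real
  assumes x: "x \<in> {1<..<2}" "x ^ 3 = 2 * x ^ 2 - x + 1"
    and y: "y \<in> {1<..<2}" "y ^ 3 = 2 * y ^ 2 - y + 1"
  shows "x = y"
proof (rule ccontr)
  assume ne: "x \<noteq> y"
  have "(x - y) * ((x - 1)^2 + (x - 1) * (y - 1) + (y - 1)^2 + (x - 1) + (y - 1)) = 0"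
    using x(2) y(2) by algebra
  then have "(x - 1)^2 + (x - 1) * (y - 1) + (y - 1)^2 + (x - 1) + (y - 1) = 0"
    using ne by simp
  moreover have "(x - 1) * (y - 1) > 0" using x(1) y(1) by simp
  ultimately show False
    using x(1) y(1) zero_le_power2[of "x - 1"] zero_le_power2[of "y - 1"]
    by (simp del: zero_le_power2)
qed

lemma q2_root: "q2 \<in> {1<..<2}" "q2 ^ 4 = 2 * q2 ^ 2 + q2 + 1"
  and q2_approx: "q2 \<in> {1.71063..1.71065}"
proof -
  have "\<exists>z\<ge>1.71063. z \<le> 1.71065 \<and> z ^ 4 - 2 * z ^ 2 - z - 1 = (0 :: real)"
    by (rule IVT') (auto simp: power_divide intro!: continuous_intros)
  then obtain z :: real where z: "z \<in> {1.71063..1.71065}" "z ^ 4 = 2 * z ^ 2 + z + 1"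
    by force
  then have "z \<in> {1<..<2}" by simp
  then have "q2 = z"
    unfolding q2_def using z(2) by (intro the_equality) (auto intro: q2_unique)
  then show "q2 \<in> {1<..<2}" "q2 ^ 4 = 2 * q2 ^ 2 + q2 + 1" "q2 \<in> {1.71063..1.71065}"
    using z by auto
qed

lemma qf_root: "qf \<in> {1<..<2}" "qf ^ 3 = 2 * qf ^ 2 - qf + 1"
  and qf_approx: "qf \<in> {1.75487..1.75489}"
proof -
  have "\<exists>z\<ge>1.75487. z \<le> 1.75489 \<and> z ^ 3 - 2 * z ^ 2 + z - 1 = (0 :: real)"
    by (rule IVT') (auto simp: power_divide intro!: continuous_intros)
  then obtain z :: real where z: "z \<in> {1.75487..1.75489}" "z ^ 3 = 2 * z ^ 2 - z + 1"
    by force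
  then have "z \<in> {1<..<2}" by simp
  then have "qf = z"
    unfolding qf_def using z(2) by (intro the_equality) (auto intro: qf_unique)
  then show "qf \<in> {1<..<2}" "qf ^ 3 = 2 * qf ^ 2 - qf + 1" "qf \<in> {1.75487..1.75489}"
    using z by auto
qed

text \<open>
  The library's \<^const>\<open>discrete\<close>, specialised to the reals, is discreteness in terms of open intervals.
\<close>

lemma discrete_real_iff:
  fixes A :: "real set"
  shows "discrete A \<longleftrightarrow>
    (\<forall>p\<in>A. \<exists>a b. p \<in> {a<..<b} \<and> ({a<..<b} - {p}) \<inter> A = {})"
proof (intro iffI ballI)
  fix p assume "discrete A" "p \<in> A"
  then obtain T where T: "open T" "T \<inter> A = {p}"
    unfolding discrete_def isolated_in_def by blast
  then obtain e where e: "e > 0" "ball p e \<subseteq> T"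
    by (metis Int_iff insertI1 open_contains_ball)
  then have "p \<in> {p - e<..<p + e} \<and> ({p - e<..<p + e} - {p}) \<inter> A = {}"
    using T(2) by (auto simp: ball_eq_greaterThanLessThan)
  then show "\<exists>a b. p \<in> {a<..<b} \<and> ({a<..<b} - {p}) \<inter> A = {}" by blast
next
  assume *: "\<forall>p\<in>A. \<exists>a b. p \<in> {a<..<b} \<and> ({a<..<b} - {p}) \<inter> A = {}"
  show "discrete A"
  proof (rule discreteI)
    fix p assume p: "p \<in> A"
    with * obtain a b where "p \<in> {a<..<b}" "({a<..<b} - {p}) \<inter> A = {}" by meson
    then have "{a<..<b} \<inter> A = {p}" using p by blast
    then show "p isolated_in A"
      unfolding isolated_in_def using p open_greaterThanLessThan by blast
  qed
qed

end

theory Submission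
  imports Defs "HOL-Computational_Algebra.Polynomial"
begin

text \<open>
Write \<open>T\<^sub>0 x = q x\<close> and \<open>T\<^sub>1 x = q x - 1\<close>. The expansions of \<open>x\<close> are the sequences of
digits along which the orbit of \<open>x\<close> stays in \<open>[0, 1/(q-1)]\<close>, and a digit can be chosen freely
exactly when the orbit visits the switch region \<open>[1/q, 1/(q(q-1))]\<close>. A point is univoque if its
orbits never meet the switch region. If \<open>x\<close> has countably many but at least two expansions,
then some point \<open>y\<close> in its orbits is thin: it is not univoque, but at every later choice one
of the two branches is univoque; otherwise a binary tree of choices would give uncountably many
expansions (\<open>ex_thin\<close>). It is therefore enough to show that every \<open>p\<close> in question has a punctured
neighbourhood of bases, within the interval and distinct from \<open>q\<^sub>2\<close>, for which there is no
thin point.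

Between the golden ratio and \<open>q\<^sub>f\<close> the univoque points below \<open>1/q\<close> are \<open>0\<close> and the values of
\<open>0\<^sup>k(10)\<^sup>\<omega>\<close>, \<open>k \<ge> 1\<close> (\<open>univoque_low\<close>). A branching point with two univoque branches gives an equation
between powers of \<open>q\<close> whose only solution in the interval is \<open>q\<^sub>2\<close> (\<open>no_two_term_relation\<close>). Away
from \<open>q\<^sub>2\<close>, therefore, a thin point produces an infinite sequence of tails
\<open>a\<^sub>1, a\<^sub>2, \<dots>\<close>, each \<open>0\<close> or the value of some \<open>0\<^sup>k(10)\<^sup>\<omega>\<close> with \<open>k \<ge> 2\<close>, such that every \<open>1 + a\<^sub>n\<close>
is thin and its orbit first enters the switch region at \<open>(1 + a\<^sub>n\<^sub>+\<^sub>1)/q\<close> or at the mirror image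
of that point (\<open>thin_switch\<close>).

For \<open>p\<close> inside the interval, consider bases \<open>q \<noteq> p\<close> close to \<open>p\<close>. For a fixed \<open>k\<close>, the
orbit of \<open>1 + a\<^sub>n\<close>, where \<open>a\<^sub>n\<close> is the \<open>k\<close>-th tail, has only finitely many possible itineraries up to its
first entry, and each equation with a fixed next tail is a nontrivial polynomial equation in \<open>q\<close>.
Hence the next tail must be arbitrarily small (\<open>next_tail_small\<close>). If \<open>a\<^sub>n\<close> is small,
however, the digit \<open>1\<close> leads from \<open>1 + a\<^sub>n\<close> to a point near \<open>q - 1\<close>, which lies in the interior of the
switch region, so \<open>a\<^sub>n\<^sub>+\<^sub>1\<close> is bounded below (\<open>next_tail_after_small\<close>). Large and small
tails would have to alternate, and in the limit \<open>p - 1\<close> would itself be the branching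
point that belongs to a tail \<open>a\<close>, or the mirror image of such a point. For every such \<open>p\<close> the
orbit of \<open>1 + a\<close> enters the switch region in its interior
(\<open>tail_forced_at_coincidence\<close>), so that the tail after \<open>a\<close> is not small, a contradiction.

At the golden ratio the point \<open>p - 1\<close> is an endpoint of the switch region and this argument
breaks down. There, with \<open>t = q\<^sup>2 - q - 1 > 0\<close> small, a small tail \<open>a\<close> is followed by \<open>t + q\<^sup>2 a\<close>,
which is small again, and two such steps in a row are incompatible with the geometric spacing of the tails
(\<open>small_tail_not_thin\<close>); the two remaining large tails are followed by small ones.
\<close>

section \<open>Orbits of the digit maps\<close>

definition attractor :: "real \<Rightarrow> real set" where
  "attractor q = {0..1 / (q - 1)}"

definition switch :: "real \<Rightarrow> real set" where
  "switch q = {1 / q..1 / (q * (q - 1))}"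

definition mirror :: "real \<Rightarrow> real \<Rightarrow> real" where
  "mirror q x = 1 / (q - 1) - x"

primrec run :: "real \<Rightarrow> real \<Rightarrow> nat list \<Rightarrow> real" where
  "run q x [] = x"
| "run q x (d # ds) = run q (q * x - real d) ds"

definition reaches :: "real \<Rightarrow> real \<Rightarrow> real \<Rightarrow> bool" where
  "reaches q x y \<longleftrightarrow> y \<in> attractor q \<and> (\<exists>ds. set ds \<subseteq> {0, 1} \<and> y = run q x ds)"

text \<open>
For \<open>1 < q < 2\<close> this is uniqueness of the expansion: every point of the attractor has an expansion,
and a second one splits off exactly at a visit to the switch region.
\<close>

definition univoque :: "real \<Rightarrow> real \<Rightarrow> bool" where
  "univoque q x \<longleftrightarrow> x \<in> attractor q \<and> (\<forall>y. reaches q x y \<longrightarrow> y \<notin> switch q)"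

text \<open>
Thin points are the form in which \<open>\<aleph>\<^sub>0\<close> expansions are used: there is choice, but never a choice
between two branches that both branch again.
\<close>

definition thin :: "real \<Rightarrow> real \<Rightarrow> bool" where
  "thin q x \<longleftrightarrow> x \<in> attractor q \<and> \<not> univoque q x \<and>
     (\<forall>y. reaches q x y \<longrightarrow> y \<in> switch q \<longrightarrow> univoque q (q * y) \<or> univoque q (q * y - 1))"

lemma run_append: "run q x (ds @ es) = run q (run q x ds) es"
  by (induction ds arbitrary: x) auto

text \<open>
The inverse branches \<open>y \<mapsto> (y + d)/q\<close> map the attractor into itself. It therefore suffices to ask that
the end point of a finite orbit lies in the attractor: the earlier points then do so automatically.
\<close>

lemma attractor_back:
  assumes "1 < q" "q * x - real d \<in> attractor q" "d \<in> {0, 1}"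
  shows "x \<in> attractor q"
proof -
  have "0 \<le> q * x" using assms by (auto simp: attractor_def)
  moreover have "q * x \<le> 1 / (q - 1) + 1" using assms by (auto simp: attractor_def)
  moreover have "1 / (q - 1) + 1 = q * (1 / (q - 1))" using assms(1) by (simp add: field_simps)
  ultimately show ?thesis using assms(1)
    by (simp add: attractor_def zero_le_mult_iff del: times_divide_eq_right)
qed

lemma run_back:
  assumes "1 < q" "run q x ds \<in> attractor q" "set ds \<subseteq> {0, 1}"
  shows "x \<in> attractor q"
  using assms(2,3)
proof (induction ds arbitrary: x)
  case (Cons d ds)
  then show ?case using attractor_back[OF assms(1), of x d] by auto
qed simp

lemma reaches_refl: "x \<in> attractor q \<Longrightarrow> reaches q x x"
  unfolding reaches_def by (metis empty_set empty_subsetI run.simps(1))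

lemma reaches_step:
  "q * x - real d \<in> attractor q \<Longrightarrow> d \<in> {0, 1} \<Longrightarrow> reaches q x (q * x - real d)"
  unfolding reaches_def by (intro conjI exI[of _ "[d]"]) auto

lemma reaches_trans:
  assumes "reaches q x y" "reaches q y z"
  shows "reaches q x z"
proof -
  obtain ds es where "set ds \<subseteq> {0, 1}" "y = run q x ds" "set es \<subseteq> {0, 1}" "z = run q y es"
    using assms unfolding reaches_def by blast
  then have "set (ds @ es) \<subseteq> {0, 1}" "z = run q x (ds @ es)" by (auto simp: run_append)
  then show ?thesis using assms(2) unfolding reaches_def by blast
qed

lemma reaches_cases:
  assumes "1 < q" "reaches q x y"
  obtains "y = x"
  | d where "d \<in> {0, 1}" "q * x - real d \<in> attractor q" "reaches q (q * x - real d) y"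
proof -
  obtain ds where ds: "set ds \<subseteq> {0, 1}" "y = run q x ds" and y: "y \<in> attractor q"
    using assms(2) unfolding reaches_def by blast
  show thesis
  proof (cases ds)
    case Nil
    then show thesis using that(1) ds by simp
  next
    case (Cons d es)
    then have "reaches q (q * x - real d) y" using ds y unfolding reaches_def by auto
    moreover have "q * x - real d \<in> attractor q"
      using run_back[OF assms(1), of "q * x - real d" es] ds y Cons by auto
    ultimately show thesis using that(2)[of d] ds Cons by auto
  qed
qed

lemma switch_iff:
  assumes "1 < q"
  shows "x \<in> switch q \<longleftrightarrow> 1 \<le> q * x \<and> q * x \<le> 1 / (q - 1)"
  using assms by (auto simp: switch_def field_simps)

lemma switch_children:
  assumes "1 < q" "x \<in> switch q"
  shows "q * x \<in> attractor q" "q * x - 1 \<in> attractor q" "x \<in> attractor q"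
proof -
  show "q * x \<in> attractor q" "q * x - 1 \<in> attractor q"
    using assms switch_iff[OF assms(1)] by (auto simp: attractor_def)
  then show "x \<in> attractor q" using attractor_back[OF assms(1), of x 0] by simp
qed

lemma univoque_reaches: "univoque q x \<Longrightarrow> reaches q x y \<Longrightarrow> univoque q y"
  unfolding univoque_def using reaches_trans reaches_def by blast

lemma thin_reaches: "thin q x \<Longrightarrow> reaches q x y \<Longrightarrow> \<not> univoque q y \<Longrightarrow> thin q y"
  unfolding thin_def using reaches_trans reaches_def by blast

lemma mirror_mirror [simp]: "mirror q (mirror q x) = x"
  by (simp add: mirror_def)

text \<open>
The mirror conjugates the two digit maps, so every statement about orbits holds with the digits
exchanged.
\<close>

lemma mirror_step: "1 < q \<Longrightarrow> mirror q (q * x - d) = q * mirror q x - (1 - d)"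
  by (simp add: mirror_def field_simps)

lemma mirror_attractor: "mirror q x \<in> attractor q \<longleftrightarrow> x \<in> attractor q"
  by (auto simp: mirror_def attractor_def)

lemma mirror_switch:
  assumes "1 < q"
  shows "mirror q x \<in> switch q \<longleftrightarrow> x \<in> switch q"
proof -
  have "q * mirror q x = 1 + 1 / (q - 1) - q * x" using assms by (simp add: mirror_def field_simps)
  then show ?thesis using switch_iff[OF assms] by auto
qed

lemma mirror_run:
  assumes "1 < q" "set ds \<subseteq> {0, 1}"
  shows "mirror q (run q x ds) = run q (mirror q x) (map (\<lambda>d. 1 - d) ds)"
  using assms(2)
proof (induction ds arbitrary: x)
  case (Cons d ds)
  have "mirror q (q * x - real d) = q * mirror q x - real (1 - d)"
    using mirror_step[OF assms(1), of x "real d"] Cons.prems by auto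
  then show ?case using Cons by simp
qed simp

lemma mirror_reaches:
  assumes "1 < q" "reaches q x y"
  shows "reaches q (mirror q x) (mirror q y)"
proof -
  obtain ds where "set ds \<subseteq> {0, 1}" "y = run q x ds"
    using assms(2) unfolding reaches_def by blast
  then have "mirror q y = run q (mirror q x) (map (\<lambda>d. 1 - d) ds)"
    "set (map (\<lambda>d. 1 - d) ds) \<subseteq> {0, 1}"
    using mirror_run[OF assms(1)] by auto
  moreover have "mirror q y \<in> attractor q"
    using assms(2) by (simp add: mirror_attractor reaches_def)
  ultimately show ?thesis unfolding reaches_def by blast
qed

lemma univoque_mirror:
  assumes "1 < q" "univoque q x"
  shows "univoque q (mirror q x)"
  unfolding univoque_def
proof (intro conjI allI impI)
  show "mirror q x \<in> attractor q"
    using assms(2) by (simp add: mirror_attractor univoque_def)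
  fix y assume "reaches q (mirror q x) y"
  then have "reaches q x (mirror q y)" using mirror_reaches[OF assms(1)] by fastforce
  then show "y \<notin> switch q"
    using assms mirror_switch univoque_def by blast
qed

lemma thin_mirror:
  assumes "1 < q" "thin q x"
  shows "thin q (mirror q x)"
  unfolding thin_def
proof (intro conjI allI impI)
  show "mirror q x \<in> attractor q"
    using assms(2) by (simp add: mirror_attractor thin_def)
  show "\<not> univoque q (mirror q x)"
    using assms univoque_mirror[OF assms(1), of "mirror q x"] by (auto simp: thin_def)
  fix y assume y: "reaches q (mirror q x) y" "y \<in> switch q"
  then have "reaches q x (mirror q y)" using mirror_reaches[OF assms(1)] by fastforce
  then have "univoque q (q * mirror q y) \<or> univoque q (q * mirror q y - 1)"
    using y assms mirror_switch thin_def by blast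
  then have "univoque q (mirror q (q * mirror q y)) \<or> univoque q (mirror q (q * mirror q y - 1))"
    using univoque_mirror[OF assms(1)] by blast
  then show "univoque q (q * y) \<or> univoque q (q * y - 1)"
    using mirror_step[OF assms(1), of "mirror q y" 0] mirror_step[OF assms(1), of "mirror q y" 1]
    by auto
qed

lemma univoque_extend:
  assumes "1 < q" "x \<in> attractor q" "x \<notin> switch q"
    and "\<And>d. d \<in> {0, 1} \<Longrightarrow> q * x - real d \<in> attractor q \<Longrightarrow> univoque q (q * x - real d)"
  shows "univoque q x"
  unfolding univoque_def
proof (intro conjI allI impI assms(2))
  fix y assume "reaches q x y"
  then show "y \<notin> switch q"
    by (cases rule: reaches_cases[OF assms(1)]) (use assms univoque_def in auto)
qed

text \<open>
Outside the switch region the digit is determined, hence nothing about the tree of choices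
changes in one step.
\<close>

lemma thin_low:
  assumes "1 < q" "q < 2" "thin q x" "x < 1 / q"
  shows "thin q (q * x)"
proof -
  have x: "x \<in> attractor q" and "\<not> univoque q x" using assms(3) by (auto simp: thin_def)
  have "q * x < 1" using assms by (simp add: field_simps)
  moreover have "1 < 1 / (q - 1)" using assms by (simp add: field_simps)
  ultimately have "q * x \<le> 1 / (q - 1)" by linarith
  then have I: "q * x \<in> attractor q" using x assms(1) by (auto simp: attractor_def)
  have "\<not> univoque q (q * x)"
  proof
    assume u: "univoque q (q * x)"
    have "univoque q x"
    proof (rule univoque_extend[OF assms(1) x])
      show "x \<notin> switch q" using \<open>q * x < 1\<close> switch_iff[OF assms(1)] by simp
      fix d :: nat assume "d \<in> {0, 1}" "q * x - real d \<in> attractor q"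
      then have "d = 0" using \<open>q * x < 1\<close> by (auto simp: attractor_def)
      then show "univoque q (q * x - real d)" using u by simp
    qed
    then show False using \<open>\<not> univoque q x\<close> by simp
  qed
  moreover have "reaches q x (q * x)" using reaches_step[of q x 0] I by simp
  ultimately show ?thesis using thin_reaches assms(3) by blast
qed

lemma thin_high:
  assumes "1 < q" "q < 2" "thin q x" "1 / (q * (q - 1)) < x"
  shows "thin q (q * x - 1)"
proof -
  have "mirror q x < 1 / q" using assms by (simp add: mirror_def field_simps)
  then have "thin q (mirror q (q * mirror q x))"
    using thin_low thin_mirror assms by blast
  then show ?thesis using mirror_step[OF assms(1), of "mirror q x" 0] by simp
qed

section \<open>Expansions as bounded orbits\<close>

definition orb :: "real \<Rightarrow> real \<Rightarrow> (nat \<Rightarrow> nat) \<Rightarrow> nat \<Rightarrow> real" where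
  "orb q x \<epsilon> n = run q x (map \<epsilon> [0..<n])"

lemma orb_Suc: "orb q x \<epsilon> (Suc n) = q * orb q x \<epsilon> n - real (\<epsilon> n)"
  by (simp add: orb_def run_append)

lemma orb_0 [simp]: "orb q x \<epsilon> 0 = x"
  by (simp add: orb_def)

lemma orb_eq:
  assumes "q > 0"
  shows "orb q x \<epsilon> n = q ^ n * (x - (\<Sum>i<n. real (\<epsilon> i) / q ^ Suc i))"
proof (induction n)
  case (Suc n)
  then have "orb q x \<epsilon> (Suc n) = q * (q ^ n * (x - (\<Sum>i<n. real (\<epsilon> i) / q ^ Suc i))) - real (\<epsilon> n)"
    unfolding orb_Suc by simp
  also have "\<dots> = q ^ Suc n * (x - (\<Sum>i<Suc n. real (\<epsilon> i) / q ^ Suc i))"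
    using assms by (simp add: algebra_simps)
  finally show ?case .
qed simp

text \<open>
The orbit point after \<open>n\<close> steps is \<open>q^n\<close> times the remainder of the series after \<open>n\<close>
terms. Remainders of expansions lie between \<open>0\<close> and a geometric tail, and conversely bounded
orbits make the remainders tend to \<open>0\<close>.
\<close>

lemma expansion_iff_orbit:
  assumes "1 < q"
  shows "\<epsilon> \<in> q_expansions q x \<longleftrightarrow> range \<epsilon> \<subseteq> {0, 1} \<and> (\<forall>n. orb q x \<epsilon> n \<in> attractor q)"
proof (intro iffI conjI allI)
  assume "\<epsilon> \<in> q_expansions q x"
  then show "range \<epsilon> \<subseteq> {0, 1}" by (simp add: q_expansions_def)
next
  fix n
  assume "\<epsilon> \<in> q_expansions q x"
  then have r: "range \<epsilon> \<subseteq> {0, 1}" and s: "(\<lambda>i. real (\<epsilon> i) / q ^ Suc i) sums x"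
    by (auto simp: q_expansions_def)
  have *: "(\<lambda>i. real (\<epsilon> (i + n)) / q ^ Suc (i + n)) sums (x - (\<Sum>i<n. real (\<epsilon> i) / q ^ Suc i))"
    using sums_split_initial_segment[OF s, of n] by simp
  have "(\<lambda>i. q ^ n * (real (\<epsilon> (i + n)) / q ^ Suc (i + n))) sums orb q x \<epsilon> n"
    using sums_mult[OF *, of "q ^ n"] orb_eq[of q] assms by simp
  moreover have "(\<lambda>i. q ^ n * (real (\<epsilon> (i + n)) / q ^ Suc (i + n))) = (\<lambda>i. real (\<epsilon> (i + n)) / q ^ Suc i)"
    using assms by (auto simp: field_simps power_add)
  ultimately have t: "(\<lambda>i. real (\<epsilon> (i + n)) / q ^ Suc i) sums orb q x \<epsilon> n" by simp
  have "(\<lambda>i. (1 / q) * (1 / q) ^ i) sums ((1 / q) * (1 / (1 - 1 / q)))"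
    by (intro sums_mult geometric_sums) (use assms in auto)
  moreover have "(1 / q) * (1 / (1 - 1 / q)) = 1 / (q - 1)" using assms by (simp add: field_simps)
  ultimately have g: "(\<lambda>i. (1 / q) * (1 / q) ^ i) sums (1 / (q - 1))" by simp
  have d: "real (\<epsilon> k) \<le> 1" for k
  proof -
    have "\<epsilon> k \<in> {0, 1}" using r by blast
    then show ?thesis by auto
  qed
  have "real (\<epsilon> (i + n)) / q ^ Suc i \<le> (1 / q) * (1 / q) ^ i" for i
    using d[of "i + n"] assms by (simp add: field_simps)
  then have "orb q x \<epsilon> n \<le> 1 / (q - 1)" using sums_le[OF _ t g] by blast
  moreover have "0 \<le> orb q x \<epsilon> n"
    by (rule sums_le[OF _ sums_zero t]) (use assms in auto)
  ultimately show "orb q x \<epsilon> n \<in> attractor q" by (simp add: attractor_def)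
next
  assume "range \<epsilon> \<subseteq> {0, 1} \<and> (\<forall>n. orb q x \<epsilon> n \<in> attractor q)"
  then have r: "range \<epsilon> \<subseteq> {0, 1}" and o: "\<forall>n. orb q x \<epsilon> n \<in> attractor q" by auto
  define s where "s n = (\<Sum>i<n. real (\<epsilon> i) / q ^ Suc i)" for n
  have s: "s n = x - orb q x \<epsilon> n * (1 / q) ^ n" for n
    using orb_eq[of q x \<epsilon> n] assms by (simp add: s_def field_simps)
  have "(\<lambda>n. orb q x \<epsilon> n * (1 / q) ^ n) \<longlonglongrightarrow> 0"
  proof (rule real_tendsto_sandwich[where f = "\<lambda>_. 0" and h = "\<lambda>n. 1 / (q - 1) * (1 / q) ^ n"])
    show "(\<lambda>n. 1 / (q - 1) * (1 / q) ^ n) \<longlonglongrightarrow> 0"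
      by (rule tendsto_mult_right_zero, rule LIMSEQ_power_zero) (use assms in auto)
    show "\<forall>\<^sub>F n in sequentially. orb q x \<epsilon> n * (1 / q) ^ n \<le> 1 / (q - 1) * (1 / q) ^ n"
      using o assms by (intro always_eventually allI mult_right_mono) (auto simp: attractor_def)
    show "\<forall>\<^sub>F n in sequentially. 0 \<le> orb q x \<epsilon> n * (1 / q) ^ n"
      using o assms by (intro always_eventually allI mult_nonneg_nonneg) (auto simp: attractor_def)
  qed auto
  then have "s \<longlonglongrightarrow> x - 0" unfolding s by (intro tendsto_intros)
  then have "(\<lambda>i. real (\<epsilon> i) / q ^ Suc i) sums x" by (simp add: sums_def s_def[abs_def])
  then show "\<epsilon> \<in> q_expansions q x" using r by (simp add: q_expansions_def)
qed

text \<open>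
At the first index where two expansions differ, both digits keep the common orbit point in the
attractor, and this means that it lies in the switch region.
\<close>

lemma two_expansions_not_univoque:
  assumes "1 < q" "\<epsilon> \<in> q_expansions q x" "\<delta> \<in> q_expansions q x" "\<epsilon> \<noteq> \<delta>"
  shows "\<not> univoque q x"
proof -
  obtain m where "\<epsilon> m \<noteq> \<delta> m" using assms(4) by blast
  then obtain n where n: "\<epsilon> n \<noteq> \<delta> n" and less: "\<And>i. i < n \<Longrightarrow> \<epsilon> i = \<delta> i"
    using exists_least_iff[of "\<lambda>n. \<epsilon> n \<noteq> \<delta> n"] by blast
  have "map \<epsilon> [0..<n] = map \<delta> [0..<n]" using less by (intro map_cong) auto
  then have y: "orb q x \<delta> n = orb q x \<epsilon> n" by (simp only: orb_def)
  have e: "range \<epsilon> \<subseteq> {0, 1}" "\<And>k. orb q x \<epsilon> k \<in> attractor q"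
    using assms(2) expansion_iff_orbit[OF assms(1)] by simp_all
  have d: "range \<delta> \<subseteq> {0, 1}" "\<And>k. orb q x \<delta> k \<in> attractor q"
    using assms(3) expansion_iff_orbit[OF assms(1)] by simp_all
  have "\<epsilon> n = 0 \<and> \<delta> n = 1 \<or> \<epsilon> n = 1 \<and> \<delta> n = 0"
    using e(1)[THEN subsetD, OF rangeI, of n] d(1)[THEN subsetD, OF rangeI, of n] n by auto
  then have "1 \<le> q * orb q x \<epsilon> n \<and> q * orb q x \<epsilon> n \<le> 1 / (q - 1)"
    using e(2)[of "Suc n"] d(2)[of "Suc n"] unfolding orb_Suc y attractor_def by fastforce
  then have "orb q x \<epsilon> n \<in> switch q" using switch_iff[OF assms(1)] by blast
  moreover have "reaches q x (orb q x \<epsilon> n)"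
    unfolding reaches_def
  proof (intro conjI exI[of _ "map \<epsilon> [0..<n]"] e(2))
    show "set (map \<epsilon> [0..<n]) \<subseteq> {0, 1}"
      unfolding set_map by (rule order_trans[OF image_mono[OF subset_UNIV] e(1)])
  qed (simp add: orb_def)
  ultimately show ?thesis unfolding univoque_def by blast
qed

text \<open>
Cantor's diagonal argument. Without thin points every non-univoque point reaches a branching
point both of whose branches are again non-univoque. Given an enumeration of the expansions, one of the two branches
disagrees with the \<open>n\<close>-th expansion; following it for all \<open>n\<close> gives an expansion that is not
enumerated.
\<close>

lemma ex_thin:
  assumes q: "1 < q" and x: "x \<in> attractor q" "\<not> univoque q x"
    and cnt: "countable (q_expansions q x)"
  shows "\<exists>y. thin q y"
proof (rule ccontr)
  assume nt: "\<nexists>y. thin q y"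
  obtain f :: "nat \<Rightarrow> nat \<Rightarrow> nat" where f: "q_expansions q x \<subseteq> range f"
    using subset_range_from_nat_into[OF cnt] by blast
  define good where
    "good ds \<longleftrightarrow> set ds \<subseteq> {0, 1} \<and> run q x ds \<in> attractor q \<and> \<not> univoque q (run q x ds)" for ds
  have ext: "\<exists>es. good (ds @ es) \<and> es \<noteq> [] \<and> (\<exists>i < length (ds @ es). (ds @ es) ! i \<noteq> g i)"
    if ds: "good ds" for ds and g :: "nat \<Rightarrow> nat"
  proof -
    obtain y where y: "reaches q (run q x ds) y" "y \<in> switch q"
      "\<not> univoque q (q * y)" "\<not> univoque q (q * y - 1)"
    proof -
      have "\<not> thin q (run q x ds)" using nt by blast
      moreover have "run q x ds \<in> attractor q" "\<not> univoque q (run q x ds)"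
        using ds unfolding good_def by blast+
      ultimately show ?thesis using that unfolding thin_def by blast
    qed
    obtain cs where cs: "set cs \<subseteq> {0, 1}" "y = run q (run q x ds) cs"
      using y(1) unfolding reaches_def by blast
    \<comment> \<open>both digits are possible after \<open>ds @ cs\<close>; take the one that differs from \<open>g\<close>\<close>
    define d where "d = (if g (length (ds @ cs)) = 0 then 1 else 0 :: nat)"
    have d: "(ds @ cs @ [d]) ! length (ds @ cs) \<noteq> g (length (ds @ cs))"
      using nth_append_length[of "ds @ cs" d "[]"] by (simp add: d_def)
    have "run q x (ds @ cs @ [d]) = q * y - real d" by (simp add: run_append cs)
    then have "good (ds @ cs @ [d])"
      using ds cs y(3,4) switch_children(1,2)[OF q y(2)] unfolding good_def d_def by simp
    moreover have "length (ds @ cs) < length (ds @ cs @ [d])" by simp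
    ultimately show ?thesis using d by blast
  qed
  have "\<exists>F. \<forall>n. good (F n) \<and> ((\<exists>es. F (Suc n) = F n @ es \<and> es \<noteq> []) \<and>
      (\<exists>i < length (F (Suc n)). F (Suc n) ! i \<noteq> f n i))"
  proof (rule dependent_nat_choice[where P = "\<lambda>_. good"])
    show "\<exists>ds. good ds" using x by (intro exI[of _ "[]"]) (simp add: good_def)
    fix ds n assume "good ds"
    then show "\<exists>es. good es \<and> (\<exists>cs. es = ds @ cs \<and> cs \<noteq> []) \<and> (\<exists>i < length es. es ! i \<noteq> f n i)"
      using ext by blast
  qed
  then obtain F where F: "\<And>n. good (F n)" "\<And>n. \<exists>es. F (Suc n) = F n @ es \<and> es \<noteq> []"
    "\<And>n. \<exists>i < length (F (Suc n)). F (Suc n) ! i \<noteq> f n i" by blast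
  have len: "n \<le> length (F n)" for n
  proof (induction n)
    case (Suc n)
    then show ?case using F(2)[of n] by (auto simp: Suc_le_eq intro: le_less_trans)
  qed simp
  have pre: "\<exists>es. F n = F m @ es" if "m \<le> n" for m n
    using that
  proof (induction rule: dec_induct)
    case (step n)
    then show ?case using F(2)[of n] by (metis append.assoc)
  qed simp
  define \<epsilon> where "\<epsilon> i = F (Suc i) ! i" for i
  have eps: "F n ! i = \<epsilon> i" if "i < length (F n)" for n i
  proof (cases "Suc i \<le> n")
    case True
    then obtain es where "F n = F (Suc i) @ es" using pre by blast
    then show ?thesis using len[of "Suc i"] by (simp add: \<epsilon>_def nth_append)
  next
    case False
    then obtain es where "F (Suc i) = F n @ es" using pre[of n "Suc i"] by auto
    then show ?thesis using that by (simp add: \<epsilon>_def nth_append)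
  qed
  have "\<epsilon> \<in> q_expansions q x"
    unfolding expansion_iff_orbit[OF q]
  proof (intro conjI allI)
    show "range \<epsilon> \<subseteq> {0, 1}"
    proof (rule image_subsetI)
      fix i
      have "\<epsilon> i \<in> set (F (Suc i))" using len[of "Suc i"] by (simp add: \<epsilon>_def)
      then show "\<epsilon> i \<in> {0, 1}" using F(1)[of "Suc i"] unfolding good_def by blast
    qed
    fix n
    have "map \<epsilon> [0..<n] = take n (F n)"
      using len[of n] eps[of _ n] by (intro nth_equalityI) auto
    then have "F n = map \<epsilon> [0..<n] @ drop n (F n)" by simp
    then have "run q (orb q x \<epsilon> n) (drop n (F n)) \<in> attractor q"
      using F(1)[of n] by (metis good_def orb_def run_append)
    moreover have "set (drop n (F n)) \<subseteq> {0, 1}"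
      using F(1)[of n] set_drop_subset by (force simp: good_def)
    ultimately show "orb q x \<epsilon> n \<in> attractor q" using run_back[OF q] by blast
  qed
  then obtain n where "\<epsilon> = f n" using f by blast
  then show False using F(3)[of n] eps by auto
qed

lemma B_aleph0_ex_thin:
  assumes "q \<in> B_aleph0"
  shows "\<exists>y. thin q y"
proof -
  obtain x where q: "1 < q" "q < 2" and x: "x \<in> {0<..<1 / (q - 1)}"
    and e: "q_expansions q x \<approx> (UNIV :: nat set)"
    using assms by (auto simp: B_aleph0_def)
  have "countable (q_expansions q x)"
    using e by (meson countableI_type countable_eqpoll)
  moreover have inf: "infinite (q_expansions q x)"
    using e eqpoll_finite_iff infinite_UNIV_nat by blast
  then obtain \<epsilon> \<delta> where "\<epsilon> \<in> q_expansions q x" "\<delta> \<in> q_expansions q x" "\<epsilon> \<noteq> \<delta>"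
    by (metis finite.emptyI finite.insertI finite_subset insertI1 subsetI)
  then have "\<not> univoque q x" using two_expansions_not_univoque q by blast
  moreover have "x \<in> attractor q" using x unfolding attractor_def by simp
  ultimately show ?thesis using ex_thin[OF q(1)] by blast
qed

section \<open>Points with a unique expansion\<close>

text \<open>
The bases strictly between the golden ratio and \<open>q\<^sub>f\<close>, without \<open>q\<^sub>2\<close>, described by the polynomial
inequalities that are used. For positive \<open>q\<close> the two rational bounds follow
from the others; they serve for crude estimates.
\<close>

definition inner_base :: "real \<Rightarrow> bool" where
  "inner_base q \<longleftrightarrow> 8 / 5 < q \<and> q < 44 / 25 \<and> q + 1 < q\<^sup>2 \<and> q ^ 3 < 2 * q\<^sup>2 - q + 1 \<and>
     q ^ 4 \<noteq> 2 * q\<^sup>2 + q + 1"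

text \<open>
The value of the expansion \<open>0\<^sup>k(10)\<^sup>\<omega>\<close>.
\<close>

definition alt_tail :: "real \<Rightarrow> nat \<Rightarrow> real" where
  "alt_tail q k = q / (q\<^sup>2 - 1) / q ^ k"

text \<open>
For the bases considered here, the values of \<open>T\<^sub>1 x\<close> at the branching points \<open>x\<close> whose branch \<open>T\<^sub>1\<close> is univoque. The exponents
\<open>0\<close> and \<open>1\<close> are missing because the corresponding points lie above the switch region.
\<close>

definition tails :: "real \<Rightarrow> real set" where
  "tails q = insert 0 (alt_tail q ` {2..})"

lemma inner_baseD:
  assumes "inner_base q"
  shows "1 < q" "q < 2" "0 < q" "1 < q\<^sup>2" "q + 1 < q\<^sup>2" "q * (q - 1)\<^sup>2 < 1"
proof -
  show "1 < q" "q < 2" "0 < q" "q + 1 < q\<^sup>2" using assms by (auto simp: inner_base_def)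
  then show "1 < q\<^sup>2" by simp
  show "q * (q - 1)\<^sup>2 < 1"
    using assms by (simp add: inner_base_def power2_eq_square power3_eq_cube algebra_simps)
qed

lemma alt_tail_0_bounds:
  assumes "inner_base q"
  shows "1 / (q * (q - 1)) < alt_tail q 0" "alt_tail q 0 < 1"
proof -
  note b = inner_baseD[OF assms]
  have "(q + 1) * (q - 1) < q\<^sup>2 * (q - 1)" using b by (intro mult_strict_right_mono) auto
  then have "q\<^sup>2 - 1 < q * (q * (q - 1))" by (simp add: power2_eq_square algebra_simps)
  moreover have "0 < q * (q - 1)" "0 < q\<^sup>2 - 1" using b by auto
  ultimately show "1 / (q * (q - 1)) < alt_tail q 0"
    unfolding alt_tail_def by (simp add: divide_less_eq less_divide_eq)
  show "alt_tail q 0 < 1"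
    using b by (simp add: alt_tail_def divide_less_eq)
qed

lemma univoque_low_step:
  assumes "inner_base q" "univoque q x" "x < 1 / q"
  shows "univoque q (q * x)"
proof -
  note b = inner_baseD[OF assms(1)]
  have x: "0 \<le> x" "x \<in> attractor q" using assms(2) by (auto simp: univoque_def attractor_def)
  have "q * x < 1" using assms(3) b by (simp add: field_simps)
  moreover have "1 < 1 / (q - 1)" using b by simp
  ultimately have "q * x \<le> 1 / (q - 1)" by linarith
  then have "q * x - real 0 \<in> attractor q" using x b by (simp add: attractor_def)
  then have "reaches q x (q * x - real 0)" by (rule reaches_step) simp
  then show ?thesis using univoque_reaches[OF assms(2)] by simp
qed

lemma univoque_high_step:
  assumes "inner_base q" "univoque q x" "1 / (q * (q - 1)) < x"
  shows "univoque q (q * x - 1)"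
proof -
  note b = inner_baseD[OF assms(1)]
  have "mirror q x < 1 / q" using assms(3) b by (simp add: mirror_def field_simps)
  then have "univoque q (mirror q (q * mirror q x))"
    using univoque_low_step univoque_mirror assms b by blast
  then show ?thesis using mirror_step[of q "mirror q x" 0] b by simp
qed

lemma univoque_gap:
  assumes "inner_base q" "univoque q x" "1 / q \<le> x"
  shows "1 / (q * (q - 1)) < x"
proof -
  have "reaches q x x" using assms(2) by (intro reaches_refl) (simp add: univoque_def)
  then have "x \<notin> switch q" using assms(2) by (simp add: univoque_def)
  then show ?thesis using assms(3) by (simp add: switch_def)
qed

text \<open>
Since \<open>q < q\<^sub>f\<close>, a univoque point between the switch region and \<open>1\<close> must follow the digits
\<open>10\<close> and return to the same range. This second iterate is affine with slope \<open>q\<^sup>2\<close>, so only its fixed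
point, the value of \<open>(10)\<^sup>\<omega>\<close>, can stay there for ever.
\<close>

lemma univoque_middle:
  assumes q: "inner_base q" and y: "univoque q y" "1 / (q * (q - 1)) < y" "y < 1"
  shows "y = alt_tail q 0"
proof -
  note b = inner_baseD[OF q]
  define c where "c = alt_tail q 0"
  have c: "q * (q * c - 1) = c" using b by (simp add: c_def alt_tail_def field_simps power2_eq_square)
  define A where "A z \<longleftrightarrow> univoque q z \<and> 1 / (q * (q - 1)) < z \<and> z < 1" for z
  have step: "A (q * (q * z - 1))" if z: "A z" for z
  proof -
    have 1: "univoque q (q * z - 1)" using z univoque_high_step[OF q] by (simp add: A_def)
    have "q * z - 1 < q - 1" using z b by (simp add: A_def)
    also have "q - 1 < 1 / (q * (q - 1))"
      using b by (simp add: less_divide_eq power2_eq_square mult_ac)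
    finally have 2: "q * z - 1 < 1 / q" using univoque_gap[OF q 1] by fastforce
    have 3: "univoque q (q * (q * z - 1))" by (rule univoque_low_step[OF q 1 2])
    have "1 / (q - 1) < q * z" using z b by (simp add: A_def field_simps)
    then have "q * (1 / (q - 1) - 1) < q * (q * z - 1)" using b by simp
    moreover have "1 / q < q * (1 / (q - 1) - 1)"
    proof -
      have "q - 1 < q * q * (2 - q)"
        using q by (simp add: inner_base_def power2_eq_square power3_eq_cube algebra_simps)
      moreover have "q * (1 / (q - 1) - 1) = q * (2 - q) / (q - 1)" using b by (simp add: field_simps)
      ultimately show ?thesis using b by (simp add: divide_less_eq less_divide_eq mult_ac)
    qed
    ultimately have "1 / (q * (q - 1)) < q * (q * z - 1)" using univoque_gap[OF q 3] by linarith
    moreover have "q * (q * z - 1) < 1" using 2 b by (simp add: field_simps)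
    ultimately show ?thesis using 3 by (simp add: A_def)
  qed
  have "A (c + (q\<^sup>2) ^ n * (y - c))" for n
  proof (induction n)
    case (Suc n)
    have "q * (q * (c + (q\<^sup>2) ^ n * (y - c)) - 1) = q * (q * c - 1) + q\<^sup>2 * ((q\<^sup>2) ^ n * (y - c))"
      by (simp add: power2_eq_square algebra_simps)
    also have "\<dots> = c + (q\<^sup>2) ^ Suc n * (y - c)" by (simp only: c) simp
    finally show ?case using step[OF Suc] by simp
  qed (use y in \<open>simp add: A_def\<close>)
  moreover have "0 < c" "c < 1" using alt_tail_0_bounds[OF q] b unfolding c_def
    by (auto intro: less_trans[rotated])
  moreover have "0 < 1 / (q * (q - 1))" using b by simp
  ultimately have bd: "(q\<^sup>2) ^ n * \<bar>y - c\<bar> < 1" for n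
  proof -
    have "\<bar>(q\<^sup>2) ^ n * (y - c)\<bar> < 1"
      using \<open>A (c + (q\<^sup>2) ^ n * (y - c))\<close> \<open>0 < c\<close> \<open>c < 1\<close> \<open>0 < 1 / (q * (q - 1))\<close>
      unfolding A_def by linarith
    then show ?thesis using b by (simp add: abs_mult)
  qed
  have "y = c"
  proof (rule ccontr)
    assume "y \<noteq> c"
    then obtain n where "1 / \<bar>y - c\<bar> < (q\<^sup>2) ^ n" using real_arch_pow[of "q\<^sup>2"] b by blast
    then show False using bd[of n] \<open>y \<noteq> c\<close> by (simp add: field_simps)
  qed
  then show ?thesis by (simp add: c_def)
qed

text \<open>
Multiplying by \<open>q\<close> until the point exceeds \<open>1/q\<close> leads into the range of the preceding lemma.
\<close>

lemma univoque_low: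
  assumes q: "inner_base q" and x: "univoque q x" "x < 1 / q"
  shows "x = 0 \<or> (\<exists>k\<ge>1. x = alt_tail q k)"
proof (cases "x = 0")
  case False
  note b = inner_baseD[OF q]
  have "0 < x" using False x by (auto simp: univoque_def attractor_def)
  then obtain m where "1 / q / x < q ^ m" using real_arch_pow[OF b(1)] by blast
  then have "1 / q \<le> q ^ m * x" using \<open>0 < x\<close> by (simp only: pos_divide_less_eq less_imp_le)
  then obtain n where n: "1 / q \<le> q ^ n * x" and less: "\<And>i. i < n \<Longrightarrow> q ^ i * x < 1 / q"
    using exists_least_iff[of "\<lambda>n. 1 / q \<le> q ^ n * x"] by force
  have u: "univoque q (q ^ i * x)" if "i \<le> n" for i
    using that
  proof (induction i)
    case (Suc i)
    then show ?case using univoque_low_step[OF q, of "q ^ i * x"] less[of i] by (simp add: mult_ac)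
  qed (use x in simp)
  have "n \<noteq> 0" using n x by (cases n) auto
  then obtain k where k: "n = Suc k" using not0_implies_Suc by blast
  have "q ^ n * x < 1" using less[of k] b by (simp add: k field_simps)
  then have "q ^ n * x = alt_tail q 0"
    using univoque_middle[OF q u] univoque_gap[OF q u n] by simp
  then have "x = alt_tail q n" using b by (simp add: alt_tail_def field_simps)
  then show ?thesis using k by auto
qed simp

lemma tails_cases:
  assumes "1 < q" "a \<in> tails q"
  obtains u where "a = q / (q\<^sup>2 - 1) * u" "u = 0 \<or> (\<exists>k\<ge>2. u = 1 / q ^ k)"
proof (cases "a = 0")
  case True
  then show ?thesis using that[of 0] by simp
next
  case False
  then obtain k where "k \<ge> 2" "a = alt_tail q k" using assms(2) by (auto simp: tails_def)
  then show ?thesis using that[of "1 / q ^ k"] by (auto simp: alt_tail_def)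
qed

lemma inverse_power_cases:
  fixes q u :: real
  assumes "1 < q" "u = 0 \<or> (\<exists>k\<ge>2. u = 1 / q ^ k)"
  shows "u = 1 / q ^ 2 \<or> u = 1 / q ^ 3 \<or> u = 1 / q ^ 4 \<or> (0 \<le> u \<and> u \<le> 1 / q ^ 5)"
proof (cases "u = 0")
  case False
  then obtain k where k: "k \<ge> 2" "u = 1 / q ^ k" using assms(2) by blast
  consider "k = 2" | "k = 3" | "k = 4" | "k \<ge> 5" using k(1) by linarith
  then show ?thesis
  proof cases
    case 4
    then have "q ^ 5 \<le> q ^ k" using power_increasing assms(1) by fastforce
    then have "1 / q ^ k \<le> 1 / q ^ 5" using assms(1) by (intro divide_left_mono) auto
    then show ?thesis using k(2) assms(1) by simp
  qed (simp_all add: k(2))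
qed (use assms(1) in simp)

section \<open>Points with exactly two expansions\<close>

text \<open>
Two univoque branches at one point would give \<open>u + v = (2 + q - q\<^sup>2)/q\<close> with \<open>u\<close> and \<open>v\<close> negative
powers of \<open>q\<close> or \<open>0\<close>. Up to order, the exponents \<open>(2,2)\<close> and \<open>(2,3)\<close> make the left side too large, \<open>(2,4)\<close> is the
equation of \<open>q\<^sub>2\<close>, \<open>(2,5)\<close> is that of \<open>q\<^sub>f\<close> and makes the left side too small for \<open>q < q\<^sub>f\<close>, and so do all
pairs of smaller terms.
\<close>

lemma no_two_term_relation:
  assumes q: "inner_base q"
    and u: "u = 0 \<or> (\<exists>k\<ge>2. u = 1 / q ^ k)" and v: "v = 0 \<or> (\<exists>k\<ge>2. v = 1 / q ^ k)"
  shows "u + v \<noteq> (2 + q - q\<^sup>2) / q"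
proof -
  note b = inner_baseD[OF q]
  define x where "x = 1 / q"
  have x: "0 < x" "x < 1" "q * x = 1" using b by (auto simp: x_def)
  have xk: "1 / q ^ k = x ^ k" for k by (simp add: x_def power_one_over)
  have main: False if s: "u + v = (2 + q - q\<^sup>2) / q" and le: "v \<le> u" and
    u: "u = x ^ 2 \<or> u = x ^ 3 \<or> u = x ^ 4 \<or> (0 \<le> u \<and> u \<le> x ^ 5)" and
    v: "v = x ^ 2 \<or> v = x ^ 3 \<or> v = x ^ 4 \<or> (0 \<le> v \<and> v \<le> x ^ 5)" for u v
  proof -
    have s': "q ^ 5 * u + q ^ 5 * v = q ^ 4 * (2 + q - q\<^sup>2)"
    proof -
      have "q ^ 5 * (u + v) = q ^ 4 * (2 + q - q\<^sup>2)"
        unfolding s using b by (simp add: field_simps eval_nat_numeral)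
      then show ?thesis by (simp add: algebra_simps)
    qed
    have p: "q ^ 5 * x ^ 2 = q ^ 3" "q ^ 5 * x ^ 3 = q ^ 2" "q ^ 5 * x ^ 4 = q" "q ^ 5 * x ^ 5 = 1"
      using b by (auto simp: x_def field_simps eval_nat_numeral)
    have dec: "x ^ 3 < x ^ 2" "x ^ 4 < x ^ 3" "x ^ 5 < x ^ 4"
      using x by (auto intro!: power_strict_decreasing)
    have U: "q ^ 5 * w = q ^ 3 \<or> q ^ 5 * w = q ^ 2 \<or> q ^ 5 * w = q \<or> q ^ 5 * w \<le> 1"
      if "w = x ^ 2 \<or> w = x ^ 3 \<or> w = x ^ 4 \<or> (0 \<le> w \<and> w \<le> x ^ 5)" for w
      using that p mult_left_mono[of w "x ^ 5" "q ^ 5"] b by auto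
    have q3: "q * (2 + q - q\<^sup>2) < 2"
    proof -
      have "q * (2 + q - q\<^sup>2) < q * 1" using b by (intro mult_strict_left_mono) linarith+
      then show ?thesis using b(2) by linarith
    qed
    have q1: "1 < q" "q < q ^ 2" "q ^ 2 < q ^ 3" using b by (auto simp: eval_nat_numeral)
    \<comment> \<open>exponents \<open>(2,5)\<close>: the first factor vanishes at \<open>q\<^sub>f\<close>\<close>
    have "q ^ 6 - q ^ 5 - 2 * q ^ 4 + q ^ 3 + 1 = (q ^ 3 - 2 * q\<^sup>2 + q - 1) * ((q\<^sup>2 - 1) * (q + 1))"
      by (simp add: algebra_simps eval_nat_numeral)
    also have "\<dots> < 0"
      using q b by (intro mult_neg_pos mult_pos_pos) (auto simp: inner_base_def)
    finally have n6: "q ^ 6 - q ^ 5 - 2 * q ^ 4 + q ^ 3 + 1 < 0" .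
    \<comment> \<open>exponents \<open>(3,3)\<close>\<close>
    have n33: "q ^ 4 * (2 + q - q\<^sup>2) > 2 * q\<^sup>2"
    proof -
      have "q ^ 3 - 2 * q - 2 < 0"
      proof -
        have "(q - 8/5) * (44/25 - q) \<ge> 0"
          using q by (intro mult_nonneg_nonneg) (simp_all add: inner_base_def)
        moreover have "(q - 8/5) * (44/25 - q) = 84/25 * q - 352/125 - q\<^sup>2" by algebra
        moreover have "q ^ 3 < 2 * q\<^sup>2 - q + 1" "q < 44/25" using q by (simp_all add: inner_base_def)
        ultimately show ?thesis by linarith
      qed
      then have "(q - 1) * (q ^ 3 - 2 * q - 2) < 0" using b by (intro mult_pos_neg) auto
      moreover have "(q - 1) * (q ^ 3 - 2 * q - 2) = 2 - q\<^sup>2 * (2 + q - q\<^sup>2)"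
        by (simp add: algebra_simps eval_nat_numeral)
      ultimately have "q\<^sup>2 * 2 < q\<^sup>2 * (q\<^sup>2 * (2 + q - q\<^sup>2))" using b by (intro mult_strict_left_mono) auto
      then show ?thesis by (simp add: eval_nat_numeral mult_ac)
    qed
    show False
    proof (cases "u = x ^ 2")
      case True
      then have s2: "q ^ 3 + q ^ 5 * v = q ^ 4 * (2 + q - q\<^sup>2)" using s' p by simp
      consider "q ^ 5 * v = q ^ 3" | "q ^ 5 * v = q ^ 2" | "q ^ 5 * v = q" | "q ^ 5 * v \<le> 1"
        using U[OF v] by blast
      then show False
      proof cases
        case 1
        then have "q ^ 3 * 2 = q ^ 3 * (q * (2 + q - q\<^sup>2))" using s2 by algebra
        then show False using q3 b by simp
      next
        case 2
        then have "q ^ 3 + q\<^sup>2 = q ^ 4 * (2 + q - q\<^sup>2)" using s2 by simp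
        moreover have "q ^ 4 * (2 + q - q\<^sup>2) - (q ^ 3 + q\<^sup>2) = - (q\<^sup>2 * ((q\<^sup>2 - q - 1) * (q\<^sup>2 - 1)))"
          by (simp add: algebra_simps eval_nat_numeral)
        ultimately have "q\<^sup>2 * ((q\<^sup>2 - q - 1) * (q\<^sup>2 - 1)) = 0" by simp
        then show False using b by auto
      next
        case 3
        then have "q ^ 3 + q = q ^ 4 * (2 + q - q\<^sup>2)" using s2 by simp
        moreover have "q ^ 4 * (2 + q - q\<^sup>2) - (q ^ 3 + q) = - (q * ((q - 1) * (q ^ 4 - 2 * q\<^sup>2 - q - 1)))"
          by (simp add: algebra_simps eval_nat_numeral)
        ultimately have "q * ((q - 1) * (q ^ 4 - 2 * q\<^sup>2 - q - 1)) = 0" by simp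
        then show False using b q by (auto simp: inner_base_def)
      next
        case 4
        have "q ^ 4 * (2 + q - q\<^sup>2) - q ^ 3 - 1 = - (q ^ 6 - q ^ 5 - 2 * q ^ 4 + q ^ 3 + 1)"
          by (simp add: algebra_simps eval_nat_numeral)
        then show False using n6 4 s2 by linarith
      qed
    next
      case False
      then have "u \<le> x ^ 3" using u dec by auto
      then have "q ^ 5 * u \<le> q\<^sup>2" "q ^ 5 * v \<le> q\<^sup>2"
        using le p mult_left_mono[of u "x ^ 3" "q ^ 5"] mult_left_mono[of v "x ^ 3" "q ^ 5"] b by auto
      then show False using s' n33 by linarith
    qed
  qed
  have "u = x ^ 2 \<or> u = x ^ 3 \<or> u = x ^ 4 \<or> (0 \<le> u \<and> u \<le> x ^ 5)"
    "v = x ^ 2 \<or> v = x ^ 3 \<or> v = x ^ 4 \<or> (0 \<le> v \<and> v \<le> x ^ 5)"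
    using inverse_power_cases[OF b(1) u] inverse_power_cases[OF b(1) v] unfolding xk .
  then show ?thesis using main[of u v] main[of v u] by (metis add.commute linear)
qed

text \<open>
The left side is the largest value of \<open>T\<^sub>1\<close> on the switch region. It is written as a multiple of
\<open>q/(q\<^sup>2 - 1)\<close>, the common factor of all tails.
\<close>

lemma switch_width:
  fixes q :: real
  assumes "1 < q"
  shows "1 / (q - 1) - 1 = q / (q\<^sup>2 - 1) * ((2 + q - q\<^sup>2) / q)"
proof -
  have "q / (q\<^sup>2 - 1) * ((2 + q - q\<^sup>2) / q) = (2 + q - q\<^sup>2) / (q\<^sup>2 - 1)"
    using assms by simp
  also have "\<dots> = (2 - q) * (q + 1) / ((q - 1) * (q + 1))"
    by (simp add: power2_eq_square algebra_simps)
  also have "\<dots> = (2 - q) / (q - 1)" using assms by simp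
  also have "\<dots> = 1 / (q - 1) - 1" using assms by (simp add: field_simps)
  finally show ?thesis by simp
qed

lemma univoque_tail:
  assumes q: "inner_base q" and a: "univoque q a" "a \<le> 1 / (q - 1) - 1"
  shows "a \<in> tails q"
proof -
  note b = inner_baseD[OF q]
  have w: "1 / (q - 1) - 1 < alt_tail q 1" 
  proof -
    have "(2 + q - q\<^sup>2) / q < 1 / q" using b by (simp add: divide_strict_right_mono)
    then have "q / (q\<^sup>2 - 1) * ((2 + q - q\<^sup>2) / q) < q / (q\<^sup>2 - 1) * (1 / q)"
      using b by (intro mult_strict_left_mono) auto
    then show ?thesis unfolding switch_width[OF b(1)] alt_tail_def by simp
  qed
  moreover have "alt_tail q 1 < 1 / q"
  proof -
    have "alt_tail q 1 = alt_tail q 0 / q"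
      by (simp only: alt_tail_def power_0 power_one_right div_by_1)
    then show ?thesis using alt_tail_0_bounds(2)[OF q] b by (simp only: divide_strict_right_mono)
  qed
  ultimately have "a < 1 / q" using a(2) by linarith
  then have "a = 0 \<or> (\<exists>k\<ge>1. a = alt_tail q k)" by (rule univoque_low[OF q a(1)])
  moreover have "k \<noteq> 1" if "a = alt_tail q k" for k using that w a(2) by auto
  ultimately show ?thesis unfolding tails_def
    by (metis Suc_1 Suc_leI atLeast_iff image_eqI insertCI le_neq_implies_less One_nat_def)
qed

text \<open>
The point \<open>(1 + a)/q\<close> has the branch \<open>a\<close>; if the other branch \<open>1 + a\<close> were univoque too, its mirror
image would also be a tail, which is impossible by the preceding lemmas.
\<close>

lemma one_plus_tail_not_univoque:
  assumes q: "inner_base q" and a: "a \<in> tails q"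
  shows "\<not> univoque q (1 + a)"
proof
  note b = inner_baseD[OF q]
  assume "univoque q (1 + a)"
  then have "univoque q (mirror q (1 + a))" using univoque_mirror b by blast
  moreover obtain u where u: "a = q / (q\<^sup>2 - 1) * u" "u = 0 \<or> (\<exists>k\<ge>2. u = 1 / q ^ k)"
    using tails_cases[OF b(1) a] .
  have "0 \<le> a" using u b by auto
  then have "mirror q (1 + a) \<le> 1 / (q - 1) - 1" by (simp add: mirror_def)
  ultimately have "mirror q (1 + a) \<in> tails q" using univoque_tail[OF q] by blast
  then obtain v where v: "mirror q (1 + a) = q / (q\<^sup>2 - 1) * v" "v = 0 \<or> (\<exists>k\<ge>2. v = 1 / q ^ k)"
    using tails_cases[OF b(1)] by blast
  have "1 / (q - 1) - 1 = q / (q\<^sup>2 - 1) * (u + v)"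
    using u(1) v(1) unfolding mirror_def distrib_left by linarith
  then have "q / (q\<^sup>2 - 1) * (u + v) = q / (q\<^sup>2 - 1) * ((2 + q - q\<^sup>2) / q)"
    using switch_width[OF b(1)] by simp
  moreover have "q / (q\<^sup>2 - 1) \<noteq> 0" using b by simp
  ultimately have "u + v = (2 + q - q\<^sup>2) / q" using mult_left_cancel by blast
  then show False using no_two_term_relation[OF q u(2) v(2)] by simp
qed

text \<open>
At a choice one branch is univoque. Up to mirroring it is the branch of digit \<open>1\<close> and hence
a tail \<open>a\<close>; the other branch \<open>1 + a\<close> carries all the remaining choices.
\<close>

lemma thin_switch:
  assumes q: "inner_base q" and t: "thin q x" and s: "x \<in> switch q"
  obtains a where "a \<in> tails q" "x = (1 + a) / q \<or> mirror q x = (1 + a) / q" "thin q (1 + a)"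
proof -
  note b = inner_baseD[OF q]
  have main: "\<exists>a\<in>tails q. x = (1 + a) / q \<and> thin q (1 + a)"
    if t: "thin q x" and s: "x \<in> switch q" and u: "univoque q (q * x - 1)" for x
  proof -
    have "q * x \<le> 1 / (q - 1)" using s switch_iff[OF b(1)] by blast
    then have a: "q * x - 1 \<in> tails q" using univoque_tail[OF q u] by simp
    have "reaches q x (q * x)"
      using reaches_step[of q x 0] switch_children(1)[OF b(1) s] by simp
    then have "thin q (q * x)"
      using thin_reaches[OF t] one_plus_tail_not_univoque[OF q a] by simp
    then show ?thesis using a b by (intro bexI[of _ "q * x - 1"]) auto
  qed
  have "reaches q x x" using t by (intro reaches_refl) (simp add: thin_def)
  then consider "univoque q (q * x - 1)" | "univoque q (q * x)" using t s unfolding thin_def by blast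
  then show thesis
  proof cases
    case 1
    then show ?thesis using main[OF t s] that by blast
  next
    case 2
    then have "univoque q (q * mirror q x - 1)"
      using univoque_mirror[OF b(1) 2] mirror_step[OF b(1), of x 0] by simp
    then show ?thesis
      using main[of "mirror q x"] thin_mirror[OF b(1) t] mirror_switch[OF b(1)] s that by blast
  qed
qed

lemma ex_thin_one_plus_tail:
  assumes q: "inner_base q" and t: "thin q x"
  shows "\<exists>a\<in>tails q. thin q (1 + a)"
proof -
  obtain y where y: "reaches q x y" "y \<in> switch q"
    using t unfolding thin_def univoque_def by blast
  have "\<not> univoque q y"
    using y reaches_refl[of y q] unfolding univoque_def reaches_def by blast
  then have "thin q y" using thin_reaches[OF t y(1)] by blast
  then show ?thesis using thin_switch[OF q _ y(2)] by blast
qed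

section \<open>Bases close to the golden ratio\<close>

lemma tails_nonneg: "1 < q \<Longrightarrow> a \<in> tails q \<Longrightarrow> 0 \<le> a"
  by (auto simp: tails_def alt_tail_def)

lemma tails_le:
  assumes "1 < q" "a \<in> tails q"
  shows "a \<le> alt_tail q 2"
proof (cases "a = 0")
  case True
  then show ?thesis using assms(1) by (simp add: alt_tail_def)
next
  case False
  then obtain k where k: "2 \<le> k" "a = alt_tail q k" using assms(2) by (auto simp: tails_def)
  have "q\<^sup>2 \<le> q ^ k" using k(1) assms(1) by (intro power_increasing) auto
  then show ?thesis unfolding k(2) alt_tail_def using assms(1)
    by (intro divide_left_mono) auto
qed

text \<open>
Nonzero tails differ by powers of \<open>q\<close>, so a strict inequality improves by a factor \<open>q\<close>.
\<close>

lemma tails_gap: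
  assumes "1 < q" "a \<in> tails q" "b \<in> tails q" "q\<^sup>2 * a < b"
  shows "q ^ 3 * a \<le> b"
proof (cases "a = 0")
  case True
  then show ?thesis using assms by simp
next
  case False
  then obtain k where k: "a = alt_tail q k" using assms(2) by (auto simp: tails_def)
  have "0 < q\<^sup>2 * a" using False tails_nonneg[OF assms(1,2)] assms(1) by simp
  then obtain j where j: "b = alt_tail q j" using assms(3,4) by (auto simp: tails_def)
  define c where "c = q / (q\<^sup>2 - 1)"
  have c: "0 < c" using assms(1) by (simp add: c_def)
  have "c * (q ^ (j + 2)) < c * q ^ k"
    using assms(4,1) unfolding k j alt_tail_def c_def[symmetric]
    by (simp add: field_simps power_add power2_eq_square)
  then have "q ^ (j + 2) < q ^ k" using c by simp
  then have "j + 2 < k" using assms(1) power_less_imp_less_exp by blast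
  then have "q ^ (j + 3) \<le> q ^ k" using assms(1) by (intro power_increasing) auto
  then have "c * q ^ (j + 3) \<le> c * q ^ k" using c by simp
  then show ?thesis using assms(1) unfolding k j alt_tail_def c_def[symmetric]
    by (simp add: field_simps power_add)
qed

text \<open>
Since \<open>1\<close> lies above the switch region, the next digit is \<open>1\<close>; the new point is at
least \<open>q - 1\<close>, hence inside or above the switch region because \<open>q\<close> exceeds the golden ratio.
\<close>

lemma thin_one_plus:
  assumes q: "inner_base q" and t: "thin q (1 + a)" and a: "0 \<le> a"
  shows "thin q (q - 1 + q * a)" "1 / q \<le> q - 1 + q * a"
proof -
  note b = inner_baseD[OF q]
  have "1 / (q * (q - 1)) < 1 + a" using alt_tail_0_bounds[OF q] a by linarith
  then have "thin q (q * (1 + a) - 1)" using thin_high t b by blast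
  then show "thin q (q - 1 + q * a)" by (simp add: algebra_simps)
  have "1 \<le> (q - 1) * q" using b by (simp add: power2_eq_square algebra_simps)
  then have "1 / q \<le> q - 1" using b by (simp only: pos_divide_le_eq)
  then show "1 / q \<le> q - 1 + q * a" using a b by (simp add: add_increasing2)
qed

lemma next_tail:
  assumes q: "inner_base q" and t: "thin q (1 + a)" and a: "0 \<le> a"
    and w: "q - 1 + q * a \<le> 1 / (q * (q - 1))"
  obtains a' where "a' \<in> tails q" "thin q (1 + a')"
    "a' = q\<^sup>2 - q - 1 + q\<^sup>2 * a \<or> a' = 1 / (q - 1) - 1 - (q\<^sup>2 - q - 1) - q\<^sup>2 * a"
proof -
  note b = inner_baseD[OF q]
  have "q - 1 + q * a \<in> switch q" using thin_one_plus(2)[OF q t a] w by (simp add: switch_def)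
  then obtain a' where a': "a' \<in> tails q" "thin q (1 + a')"
    "q - 1 + q * a = (1 + a') / q \<or> mirror q (q - 1 + q * a) = (1 + a') / q"
    using thin_switch[OF q thin_one_plus(1)[OF q t a]] by blast
  have m: "q * mirror q (q - 1 + q * a) = 1 + 1 / (q - 1) - q * (q - 1 + q * a)"
    using b by (simp add: mirror_def field_simps)
  have "1 + a' = q * (q - 1 + q * a) \<or> 1 + a' = q * mirror q (q - 1 + q * a)"
    using a'(3) b by auto
  then have "a' = q\<^sup>2 - q - 1 + q\<^sup>2 * a \<or> a' = 1 / (q - 1) - 1 - (q\<^sup>2 - q - 1) - q\<^sup>2 * a"
    unfolding m by (auto simp: algebra_simps power2_eq_square)
  then show thesis using that a' by blast
qed

lemma golden_bounds:
  assumes q: "inner_base q" and t: "q\<^sup>2 - q - 1 < 1 / 1000"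
  shows "1618 / 1000 < q" "q < 16185 / 10000" "q ^ 4 < 7"
    "999 / 1000 < alt_tail q 0" "1 / 10 < alt_tail q 4"
proof -
  note b = inner_baseD[OF q]
  show l: "1618 / 1000 < q"
  proof (rule ccontr)
    assume "\<not> 1618 / 1000 < q"
    then have "q * (q - 1) \<le> 1618 / 1000 * (1618 / 1000 - 1)" using b by (intro mult_mono) auto
    then show False using b(5) by (simp add: power2_eq_square algebra_simps)
  qed
  show u: "q < 16185 / 10000"
  proof (rule ccontr)
    assume "\<not> q < 16185 / 10000"
    then have "16185 / 10000 * (16185 / 10000 - 1) \<le> q * (q - 1)" using b by (intro mult_mono) auto
    then show False using t by (simp add: power2_eq_square algebra_simps)
  qed
  have "q\<^sup>2 < 262 / 100" using t u by simp
  then have "q\<^sup>2 * q\<^sup>2 < 262 / 100 * (262 / 100)" using b by (intro mult_strict_mono) auto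
  then show q4: "q ^ 4 < 7" by (simp add: eval_nat_numeral mult_ac)
  have "999 / 1000 * (q\<^sup>2 - 1) < q" using t l by (simp add: field_simps)
  then show c: "999 / 1000 < alt_tail q 0" using b by (simp add: alt_tail_def less_divide_eq)
  have "1 / 10 * q ^ 4 < alt_tail q 0" using q4 c by simp
  then have "1 / 10 < alt_tail q 0 / q ^ 4" using b by (simp only: pos_less_divide_eq zero_less_power)
  then show "1 / 10 < alt_tail q 4" by (simp add: alt_tail_def)
qed

text \<open>
At the golden ratio itself the equation reads \<open>u + v = 1/q\<close> and has the solution
\<open>q\<^sup>-\<^sup>2 + q\<^sup>-\<^sup>3 = 1/q\<close>. For larger bases this solution disappears because its defect
\<open>(q\<^sup>2 - q - 1)/q\<^sup>3\<close> is smaller than the perturbation \<open>(q\<^sup>2 - q - 1) q\<close>, and all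
other pairs miss the value by a margin.
\<close>

lemma no_golden_relation:
  assumes q: "inner_base q" and t: "q\<^sup>2 - q - 1 < 1 / 1000"
    and u: "u = 0 \<or> (\<exists>k\<ge>2. u = 1 / q ^ k)" and v: "v = 0 \<or> (\<exists>k\<ge>2. v = 1 / q ^ k)"
  shows "u + v \<noteq> 1 / q - (q\<^sup>2 - q - 1) * q"
proof
  assume s: "u + v = 1 / q - (q\<^sup>2 - q - 1) * q"
  note b = inner_baseD[OF q] and g = golden_bounds[OF q t]
  define d where "d = q\<^sup>2 - q - 1"
  have d: "0 < d" "d < 1 / 1000" using b t by (auto simp: d_def)
  have q2: "q\<^sup>2 = q + 1 + d" by (simp add: d_def)
  have q3: "q ^ 3 = 2 * q + 1 + d + d * q"
    using q2 by (simp add: power2_eq_square power3_eq_cube algebra_simps)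
  have dq: "0 < d * q" using d b by simp
  have "1 < q ^ 4" using b by simp
  then have dq5: "d * q < d * q * q ^ 4" using mult_strict_left_mono[of 1 "q ^ 4" "d * q"] dq by simp
  have "d * q * q ^ 4 < 1 / 1000 * (16185 / 10000) * 7"
    using d g b by (intro mult_strict_mono mult_pos_pos) auto
  then have dq5': "d * q * q ^ 4 < 2 / 100" by simp
  have V: "q ^ 4 * w = q\<^sup>2 \<or> q ^ 4 * w = q \<or> q ^ 4 * w \<le> 1"
    if w: "w = 0 \<or> (\<exists>k\<ge>2. w = 1 / q ^ k)" for w
  proof -
    have 1: "1 / q ^ 5 \<le> 1 / q ^ 4"
      using b by (intro divide_left_mono power_increasing) auto
    have 2: "q ^ 4 * w \<le> 1" if "w \<le> 1 / q ^ 4"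
      using mult_left_mono[OF that, of "q ^ 4"] b by simp
    have 3: "q ^ 4 * (1 / q ^ 2) = q\<^sup>2" "q ^ 4 * (1 / q ^ 3) = q"
      using b by (auto simp: field_simps eval_nat_numeral)
    consider "w = 1 / q ^ 2" | "w = 1 / q ^ 3" | "w \<le> 1 / q ^ 4"
      using inverse_power_cases[OF b(1) w] 1 by linarith
    then show ?thesis using 2 3 by cases auto
  qed
  have "q ^ 4 * (u + v) = q ^ 3 - d * q * q ^ 4"
    unfolding s d_def[symmetric] using b by (simp add: field_simps eval_nat_numeral)
  then have "q ^ 4 * u + q ^ 4 * v = 2 * q + 1 + d + d * q - d * q * q ^ 4"
    unfolding q3 distrib_left .
  then show False using V[OF u] V[OF v] g(1,2) d dq dq5 dq5' unfolding q2 by linarith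
qed

text \<open>
Of the two possible successors of a small tail only the one without mirroring remains: the mirrored
one would satisfy the relation excluded just before.
\<close>

lemma thin_tail_near_golden:
  assumes q: "inner_base q" and t: "q\<^sup>2 - q - 1 < 1 / 1000" and a: "a \<in> tails q" "a \<le> alt_tail q 4"
    and th: "thin q (1 + a)"
  obtains a' where "a' \<in> tails q" "thin q (1 + a')" "a' = q\<^sup>2 - q - 1 + q\<^sup>2 * a"
proof -
  note b = inner_baseD[OF q] and g = golden_bounds[OF q t]
  have a0: "0 \<le> a" using tails_nonneg[OF b(1) a(1)] .
  define c where "c = q / (q\<^sup>2 - 1)"
  have c: "0 < c" using b by (simp add: c_def)
  have w: "q - 1 + q * a \<le> 1 / (q * (q - 1))"
  proof -
    have "q * a \<le> q * alt_tail q 4" using a b by simp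
    also have "\<dots> = alt_tail q 0 * (1 / q ^ 3)"
      using b by (simp add: alt_tail_def field_simps eval_nat_numeral)
    also have "\<dots> \<le> 1 * (1 / q ^ 3)"
      using alt_tail_0_bounds(2)[OF q] b by (intro mult_right_mono) auto
    also have "\<dots> \<le> 1 / 4"
    proof -
      have "(16 / 10) ^ 3 \<le> q ^ 3" using g by (intro power_mono) auto
      moreover have "4 \<le> (16 / 10 :: real) ^ 3" by (simp add: power3_eq_cube)
      ultimately have "4 \<le> q ^ 3" by linarith
      then show ?thesis using b by (simp add: divide_le_eq)
    qed
    finally have "q - 1 + q * a \<le> 9 / 10" using g by simp
    moreover have "9 / 10 \<le> 1 / (q * (q - 1))"
    proof -
      have "q * (q - 1) < 1001 / 1000" using t by (simp add: power2_eq_square algebra_simps)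
      moreover have "0 < q * (q - 1)" using b by simp
      ultimately show ?thesis by (simp add: le_divide_eq)
    qed
    ultimately show ?thesis by linarith
  qed
  obtain a' where a': "a' \<in> tails q" "thin q (1 + a')"
    "a' = q\<^sup>2 - q - 1 + q\<^sup>2 * a \<or> a' = 1 / (q - 1) - 1 - (q\<^sup>2 - q - 1) - q\<^sup>2 * a"
    using next_tail[OF q th a0 w] .
  have "a' \<noteq> 1 / (q - 1) - 1 - (q\<^sup>2 - q - 1) - q\<^sup>2 * a"
  proof
    assume eq: "a' = 1 / (q - 1) - 1 - (q\<^sup>2 - q - 1) - q\<^sup>2 * a"
    obtain v where v: "a' = c * v" "v = 0 \<or> (\<exists>k\<ge>2. v = 1 / q ^ k)"
      using tails_cases[OF b(1) a'(1)] unfolding c_def .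
    obtain u where u: "a = c * u" "u = 0 \<or> (\<exists>k\<ge>2. u = 1 / q ^ k)"
      using tails_cases[OF b(1) a(1)] unfolding c_def .
    have u2: "q\<^sup>2 * u = 0 \<or> (\<exists>k\<ge>2. q\<^sup>2 * u = 1 / q ^ k)"
    proof (cases "u = 0")
      case False
      then obtain k where k: "k \<ge> 2" "u = 1 / q ^ k" using u by blast
      have "c * (1 / q ^ k) \<le> c * (1 / q ^ 4)" using a(2) unfolding u k alt_tail_def c_def by simp
      then have "q ^ 4 \<le> q ^ k" using c b by (simp add: field_simps)
      then have "4 \<le> k" using b(1) power_le_imp_le_exp by blast
      then obtain m where m: "k = m + 2" "2 \<le> m"
        using that[of "k - 2"] by (simp add: le_diff_conv2)
      then show ?thesis using k b by (intro disjI2 exI[of _ m]) (simp add: power_add power2_eq_square)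
    qed simp
    have e: "1 / (q - 1) - 1 = c * ((2 + q - q\<^sup>2) / q)" using switch_width[OF b(1)] by (simp only: c_def)
    have d: "q\<^sup>2 - q - 1 = c * ((q\<^sup>2 - q - 1) * ((q\<^sup>2 - 1) / q))"
      using b by (simp add: c_def)
    have "c * (v + q\<^sup>2 * u) = c * ((2 + q - q\<^sup>2) / q - (q\<^sup>2 - q - 1) * ((q\<^sup>2 - 1) / q))"
      using eq e d u(1) v(1) by (simp only: right_diff_distrib distrib_left) (simp add: mult_ac)
    then have "v + q\<^sup>2 * u = (2 + q - q\<^sup>2) / q - (q\<^sup>2 - q - 1) * ((q\<^sup>2 - 1) / q)"
      using c by simp
    also have "\<dots> = 1 / q - (q\<^sup>2 - q - 1) * q"
      using b by (simp add: field_simps power2_eq_square)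
    finally show False using no_golden_relation[OF q t v(2) u2] by simp
  qed
  then show thesis using that a' by blast
qed

text \<open>
With \<open>t = q\<^sup>2 - q - 1\<close>, two consecutive steps give \<open>a' = t + q\<^sup>2 a\<close> and \<open>a'' = t + q\<^sup>2 a'\<close>. By the gaps between
tails \<open>a'' \<ge> q\<^sup>3 a'\<close>, so \<open>(q\<^sup>3 - q\<^sup>2) a' \<le> t \<le> a'\<close>, although \<open>q\<^sup>3 - q\<^sup>2 > 1\<close>.
\<close>

lemma small_tail_not_thin:
  assumes q: "inner_base q" and t: "q\<^sup>2 - q - 1 < 1 / 1000" and a: "a \<in> tails q" "a \<le> alt_tail q 4"
  shows "\<not> thin q (1 + a)"
proof
  assume th: "thin q (1 + a)"
  note b = inner_baseD[OF q] and g = golden_bounds[OF q t]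
  define d where "d = q\<^sup>2 - q - 1"
  have d: "0 < d" "d < 1 / 1000" using b t by (auto simp: d_def)
  have a0: "0 \<le> a" using tails_nonneg[OF b(1) a(1)] .
  obtain a' where a': "a' \<in> tails q" "thin q (1 + a')" "a' = d + q\<^sup>2 * a"
    using thin_tail_near_golden[OF q t a th] unfolding d_def .
  have "q ^ 3 * a \<le> a'" using tails_gap[OF b(1) a(1) a'(1)] a'(3) d by simp
  then have "q * (q\<^sup>2 * a) \<le> a'" by (simp add: eval_nat_numeral mult_ac)
  moreover have "8 / 5 * (q\<^sup>2 * a) \<le> q * (q\<^sup>2 * a)" using g(1) a0 b by (intro mult_right_mono) auto
  ultimately have "a' \<le> 1 / 10" using a'(3) d by linarith
  then have s: "a' \<le> alt_tail q 4" using g(5) by linarith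
  obtain a'' where a'': "a'' \<in> tails q" "a'' = d + q\<^sup>2 * a'"
    using thin_tail_near_golden[OF q t a'(1) s a'(2)] unfolding d_def .
  have "q ^ 3 * a' \<le> a''" using tails_gap[OF b(1) a'(1) a''(1)] a''(2) d by simp
  then have "(q ^ 3 - q\<^sup>2) * a' \<le> d" using a''(2) by (simp add: algebra_simps)
  also have "d \<le> a'" using a'(3) a0 b by simp
  finally have "(q ^ 3 - q\<^sup>2) * a' \<le> 1 * a'" by simp
  moreover have "0 < a'" using a'(3) d a0 b by (simp add: add_pos_nonneg)
  ultimately have "q ^ 3 - q\<^sup>2 \<le> 1" by (simp only: mult_le_cancel_right_pos)
  moreover have "q ^ 3 - q\<^sup>2 = q + d * q"
    by (simp add: d_def power2_eq_square power3_eq_cube algebra_simps)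
  moreover have "0 < d * q" using d b by simp
  ultimately show False using b by simp
qed

text \<open>
Such a point lies in the switch region, just below its upper end, so its tail would be either too large
or of the order of \<open>q\<^sup>2 - q - 1\<close> and hence small.
\<close>

lemma upper_return_not_thin:
  assumes q: "inner_base q" and t: "q\<^sup>2 - q - 1 < 1 / 1000" and \<beta>: "1 \<le> \<beta>" "\<beta> \<le> q"
  shows "\<not> thin q (alt_tail q 0 - \<beta> * (q\<^sup>2 - q - 1))"
proof
  define d where "d = q\<^sup>2 - q - 1"
  define y where "y = alt_tail q 0 - \<beta> * d"
  assume "thin q (alt_tail q 0 - \<beta> * (q\<^sup>2 - q - 1))"
  then have th: "thin q y" by (simp add: y_def d_def)
  note b = inner_baseD[OF q] and g = golden_bounds[OF q t]
  have d: "0 < d" "d < 1 / 1000" using b t by (auto simp: d_def)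
  define s where "s = 1 / (q\<^sup>2 - 1)"
  have s: "s * (q\<^sup>2 - 1) = 1" "0 < s" "s < 1" using b by (auto simp: s_def)
  have c: "alt_tail q 0 = q * s" by (simp add: alt_tail_def s_def)
  have m: "1 / (q - 1) = (q + 1) * s"
    using b by (simp add: s_def field_simps power2_eq_square)
  have bd: "0 \<le> q * \<beta> * d" "q * \<beta> * d \<le> q * q * d" "d \<le> q * \<beta> * d"
  proof -
    have 1: "1 \<le> q * \<beta>" "q * \<beta> \<le> q * q"
      using \<beta> b mult_mono[of 1 q 1 \<beta>] mult_left_mono[of \<beta> q q] by simp_all
    show "q * \<beta> * d \<le> q * q * d" using 1 d by (intro mult_right_mono) simp_all
    have "1 * d \<le> q * \<beta> * d" using 1 d by (intro mult_right_mono) simp_all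
    then show "0 \<le> q * \<beta> * d" "d \<le> q * \<beta> * d" using d by simp_all
  qed
  have qqd: "q * q * d \<le> 3 / 1000"
  proof -
    have "q * q \<le> 3" using t g(2) by (simp add: power2_eq_square)
    then have "q * q * d \<le> 3 * (1 / 1000)" using d b by (intro mult_mono) auto
    then show ?thesis by simp
  qed
  have qy: "q * y = q * alt_tail q 0 - q * \<beta> * d" by (simp add: y_def algebra_simps)
  have qc: "q * alt_tail q 0 = (q + 1) * s + s * d"
    by (simp add: c d_def power2_eq_square algebra_simps)
  have qc': "1618 / 1000 * (999 / 1000) \<le> q * alt_tail q 0" using g b by (intro mult_mono) auto
  have "s * d \<le> d" using s d by simp
  then have "q * y \<le> 1 / (q - 1)" using bd unfolding qy qc m by linarith
  moreover have "1 \<le> q * y" using qc' bd qqd unfolding qy by simp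
  ultimately have sw: "y \<in> switch q" using switch_iff[OF b(1)] by blast
  obtain a where a: "a \<in> tails q" "y = (1 + a) / q \<or> mirror q y = (1 + a) / q" "thin q (1 + a)"
    using thin_switch[OF q th sw] .
  from a(2) show False
  proof
    assume "y = (1 + a) / q"
    then have "a = q * y - 1" using b by simp
    then have "6 / 10 < a" using qc' bd qqd unfolding qy by simp
    moreover have "a \<le> alt_tail q 0 / q\<^sup>2" using tails_le[OF b(1) a(1)] by (simp add: alt_tail_def)
    moreover have "alt_tail q 0 / q\<^sup>2 \<le> 1 / q\<^sup>2" using alt_tail_0_bounds(2)[OF q] b
      by (intro divide_right_mono) auto
    moreover have "1 / q\<^sup>2 < 1 / 2"
    proof -
      have "2 < q\<^sup>2" using b by linarith
      then show ?thesis by (simp add: divide_less_eq)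
    qed
    ultimately show False by linarith
  next
    assume "mirror q y = (1 + a) / q"
    then have "q * mirror q y = 1 + a" using b by simp
    moreover have "q * mirror q y = 1 + 1 / (q - 1) - q * y" using b by (simp add: mirror_def field_simps)
    ultimately have "a = q * \<beta> * d - s * d" unfolding qy qc m by simp
    moreover have "0 < s * d" using s d by simp
    ultimately have "a \<le> 1 / 10" using bd qqd by linarith
    then have "a \<le> alt_tail q 4" using g by linarith
    then show False using small_tail_not_thin[OF q t a(1)] a(3) by simp
  qed
qed

text \<open>
Only the tails with exponents \<open>2\<close> and \<open>3\<close> are not small. From these the mirrored orbit leads to
the points treated in the preceding lemma, with \<open>\<beta> = q\<close> and \<open>\<beta> = 1\<close>.
\<close>

lemma no_thin_near_golden:
  assumes q: "inner_base q" and t: "q\<^sup>2 - q - 1 < 1 / 1000"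
  shows "\<not> thin q x"
proof
  assume "thin q x"
  then obtain a where a: "a \<in> tails q" and th: "thin q (1 + a)" using ex_thin_one_plus_tail[OF q] by blast
  note b = inner_baseD[OF q] and g = golden_bounds[OF q t]
  define d where "d = q\<^sup>2 - q - 1"
  have d: "0 < d" "d < 1 / 1000" using b t by (auto simp: d_def)
  define s where "s = 1 / (q\<^sup>2 - 1)"
  have s: "s * (q\<^sup>2 - 1) = 1" "0 < s" "s < 1" using b by (auto simp: s_def)
  define y where "y = 1 / q"
  have y: "q * y = 1" "0 < y" "y < 1" using b by (auto simp: y_def)
  have m: "1 / (q - 1) = (q + 1) * s"
    using b by (simp add: s_def field_simps power2_eq_square)
  have c: "alt_tail q k = q * s * y ^ k" for k
    by (simp add: alt_tail_def s_def y_def power_one_over)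
  have c1: "alt_tail q 0 < 1" by (rule alt_tail_0_bounds(2)[OF q])
  have a0: "0 \<le> a" using tails_nonneg[OF b(1) a] .
  define w where "w = mirror q (q - 1 + q * a)"
  have w: "thin q w" unfolding w_def
    using thin_mirror[OF b(1)] thin_one_plus(1)[OF q th a0] by blast
  have w': "w = (q + 1) * s - (q - 1) - q * a" by (simp add: w_def mirror_def m)
  have "a = alt_tail q 2 \<or> a = alt_tail q 3 \<or> a \<le> alt_tail q 4"
  proof (cases "a = 0")
    case True
    then show ?thesis using b by (simp add: alt_tail_def)
  next
    case False
    then obtain k where k: "2 \<le> k" "a = alt_tail q k" using a by (auto simp: tails_def)
    have "alt_tail q k \<le> alt_tail q 4" if "4 \<le> k"
      unfolding alt_tail_def using b power_increasing[OF that, of q]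
      by (intro divide_left_mono) auto
    then show ?thesis using k by (cases "k \<ge> 4") (auto simp: numeral_eq_Suc le_Suc_eq not_le less_Suc_eq_le)
  qed
  then consider "a = alt_tail q 2" | "a = alt_tail q 3" using small_tail_not_thin[OF q t a] th by blast
  then show False
  proof cases
    case 1
    have e: "q\<^sup>2 * w = alt_tail q 0 - q * d"
    proof -
      have "q * a = s" using y unfolding 1 c by algebra
      then have "q\<^sup>2 * w = q\<^sup>2 * (q * s - (q - 1))" unfolding w' by (simp add: algebra_simps)
      also have "\<dots> = q * s - q * d" using s(1) unfolding d_def by algebra
      finally show ?thesis by (simp add: c)
    qed
    then have "q\<^sup>2 * w < 1" using c1 d b by (simp add: less_trans[OF _ c1])
    then have "q * (q * w) < 1" by (simp add: power2_eq_square mult_ac)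
    then have l1: "q * w < 1 / q" using b by (simp add: less_divide_eq mult_ac)
    moreover have "1 / q < 1" using b by simp
    ultimately have "q * w < 1" by linarith
    then have l2: "w < 1 / q" using b by (simp add: less_divide_eq mult_ac)
    have "thin q (q * (q * w))" using thin_low b w l1 l2 by blast
    then have "thin q (alt_tail q 0 - q * d)" using e by (simp add: power2_eq_square mult_ac)
    then show False using upper_return_not_thin[OF q t, of q] b by (simp add: d_def)
  next
    case 2
    have e: "q * w = alt_tail q 0 - 1 * d"
    proof -
      have "q * (q * a) = s" using y unfolding 2 c by algebra
      then have "q * w = q * (q + 1) * s - q * (q - 1) - s" unfolding w' by (simp add: algebra_simps)
      also have "\<dots> = q * s - d" using s(1) unfolding d_def by algebra
      finally show ?thesis by (simp add: c)
    qed
    then have "q * w < 1" using c1 d by simp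
    then have "w < 1 / q" using b by (simp add: less_divide_eq mult_ac)
    then have "thin q (q * w)" using thin_low b w by blast
    then show False using upper_return_not_thin[OF q t, of 1] b e by (simp add: d_def)
  qed
qed

section \<open>Itineraries under variation of the inner_base\<close>

text \<open>
The digits of \<open>w\<close> are dictated by strict inequalities, and the last point is an interior point of the switch
region. These are open conditions, so they persist under small changes of the base.
\<close>

primrec forced :: "real \<Rightarrow> real \<Rightarrow> nat list \<Rightarrow> bool" where
  "forced q x [] \<longleftrightarrow> 1 / q < x \<and> x < 1 / (q * (q - 1))"
| "forced q x (d # ds) \<longleftrightarrow>
     (d = 0 \<and> x < 1 / q \<or> d = 1 \<and> 1 / (q * (q - 1)) < x) \<and> forced q (q * x - real d) ds"

lemma forced_thin:
  assumes "1 < q" "q < 2" "forced q x w" "thin q x"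
  shows "thin q (run q x w)" "1 / q < run q x w" "run q x w < 1 / (q * (q - 1))"
proof -
  have "thin q (run q x w) \<and> 1 / q < run q x w \<and> run q x w < 1 / (q * (q - 1))"
    using assms(3,4)
  proof (induction w arbitrary: x)
    case (Cons d w)
    then have "thin q (q * x - real d)"
      using thin_low[OF assms(1,2), of x] thin_high[OF assms(1,2), of x] by auto
    then show ?case using Cons by simp
  qed simp
  then show "thin q (run q x w)" "1 / q < run q x w" "run q x w < 1 / (q * (q - 1))" by auto
qed

lemma forced_run:
  "forced q x w \<Longrightarrow> 1 / q < run q x w \<and> run q x w < 1 / (q * (q - 1))"
  by (induction w arbitrary: x) auto

lemma eventually_nhds_less:
  fixes f g :: "real \<Rightarrow> real"
  assumes "isCont f p" "isCont g p" "f p < g p"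
  shows "\<forall>\<^sub>F q in nhds p. f q < g q"
proof -
  have "((\<lambda>q. g q - f q) \<longlongrightarrow> g p - f p) (nhds p)"
    using assms(1,2) by (intro tendsto_diff) (simp_all add: isCont_def tendsto_at_iff_tendsto_nhds)
  then have "\<forall>\<^sub>F q in nhds p. 0 < g q - f q"
    by (rule order_tendstoD) (use assms(3) in simp)
  then show ?thesis by eventually_elim simp
qed

lemma eventually_at_of_nhds:
  "eventually P (nhds (p :: real)) \<Longrightarrow> eventually P (at p)"
  unfolding eventually_at_filter by (auto elim: eventually_mono)

lemma isCont_switch_ends:
  assumes "1 < p"
  shows "isCont (\<lambda>q :: real. 1 / q) p" "isCont (\<lambda>q :: real. 1 / (q * (q - 1))) p"
  using assms by (auto intro!: continuous_intros)

lemma eventually_inner_base: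
  assumes "inner_base p"
  shows "\<forall>\<^sub>F q in nhds p. inner_base q"
proof -
  have "open {q. inner_base q}"
    unfolding inner_base_def
    by (intro open_Collect_conj open_Collect_less open_Collect_neq continuous_intros)
  then show ?thesis using assms eventually_nhds by blast
qed

lemma isCont_run: "isCont u p \<Longrightarrow> isCont (\<lambda>q. run q (u q) w) p"
proof (induction w arbitrary: u)
  case (Cons d w)
  have "isCont (\<lambda>q. q * u q - real d) p" using Cons.prems by (intro continuous_intros)
  then show ?case using Cons.IH by simp
qed simp

lemma eventually_forced:
  assumes "1 < p" "isCont u p" "forced p (u p) w"
  shows "\<forall>\<^sub>F q in nhds p. forced q (u q) w"
  using assms(2,3)
proof (induction w arbitrary: u)
  case Nil
  have "\<forall>\<^sub>F q in nhds p. 1 / q < u q" "\<forall>\<^sub>F q in nhds p. u q < 1 / (q * (q - 1))"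
    using Nil isCont_switch_ends[OF assms(1)] by (auto intro: eventually_nhds_less)
  then show ?case by eventually_elim simp
next
  case (Cons d w)
  have "isCont (\<lambda>q. q * u q - real d) p" using Cons.prems by (intro continuous_intros)
  then have f: "\<forall>\<^sub>F q in nhds p. forced q (q * u q - real d) w"
    using Cons.IH[of "\<lambda>q. q * u q - real d"] Cons.prems by simp
  consider "d = 0" "u p < 1 / p" | "d = 1" "1 / (p * (p - 1)) < u p" using Cons.prems by auto
  then show ?case
  proof cases
    case 1
    have "\<forall>\<^sub>F q in nhds p. u q < 1 / q"
      using Cons.prems 1 isCont_switch_ends[OF assms(1)] by (auto intro: eventually_nhds_less)
    then show ?thesis using f by eventually_elim (simp add: 1(1))
  next
    case 2
    have "\<forall>\<^sub>F q in nhds p. 1 / (q * (q - 1)) < u q"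
      using Cons.prems 2 isCont_switch_ends[OF assms(1)] by (auto intro: eventually_nhds_less)
    then show ?thesis using f by eventually_elim (simp add: 2(1))
  qed
qed

text \<open>
The set \<open>W\<close> lists candidate itineraries up to a visit to the switch region.
\<close>

definition enters :: "real \<Rightarrow> real \<Rightarrow> nat list set \<Rightarrow> bool" where
  "enters q x W \<longleftrightarrow> (\<exists>w\<in>W. thin q (run q x w) \<and> run q x w \<in> switch q)"

lemma forced_enters:
  "1 < q \<Longrightarrow> q < 2 \<Longrightarrow> forced q x w \<Longrightarrow> thin q x \<Longrightarrow> w \<in> W \<Longrightarrow> enters q x W"
  using forced_thin[of q x w] unfolding enters_def switch_def by fastforce

lemma enters_in_switch: "thin q x \<Longrightarrow> x \<in> switch q \<Longrightarrow> [] \<in> W \<Longrightarrow> enters q x W"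
  unfolding enters_def by force

lemma golden_orbit_of_one:
  assumes "inner_base p"
  shows "1 / p < p - 1" "p - 1 < 1 / (p * (p - 1))" "1 / (p * (p - 1)) < 1"
proof -
  note b = inner_baseD[OF assms]
  have "1 < (p - 1) * p" using b by (simp add: power2_eq_square algebra_simps)
  then show "1 / p < p - 1" using b by (simp only: pos_divide_less_eq)
  show "1 / (p * (p - 1)) < 1" using alt_tail_0_bounds[OF assms] by linarith
  have "(p - 1) * (p * (p - 1)) < 1" using b(6) by (simp add: power2_eq_square mult_ac)
  then show "p - 1 < 1 / (p * (p - 1))" using b by (simp only: pos_less_divide_eq mult_pos_pos diff_gt_0_iff_gt)
qed

lemma mirror_of_one_less:
  assumes p: "inner_base p"
  shows "1 / p < mirror p (p - 1)" "mirror p (p - 1) < 1 / (p * (p - 1))"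
proof -
  note b = inner_baseD[OF p] and g = golden_orbit_of_one[OF p]
  have "1 / (p - 1) = 1 / p + 1 / (p * (p - 1))" using b(1) by (simp add: field_simps)
  then show "1 / p < mirror p (p - 1)" "mirror p (p - 1) < 1 / (p * (p - 1))"
    unfolding mirror_def using g by argo+
qed

lemma upper_end_orbit:
  assumes p: "inner_base p" and x: "x = 1 / (p * (p - 1))"
  shows "p * (p * x - 1) = mirror p (p - 1)" "p * x - 1 < 1 / p"
proof -
  note b = inner_baseD[OF p] and g = golden_orbit_of_one[OF p]
  have e: "p * x = 1 / (p - 1)" using b by (simp add: x)
  show m: "p * (p * x - 1) = mirror p (p - 1)"
  proof -
    have "p * (1 / (p - 1)) = 1 + 1 / (p - 1)" using b(1) by (simp add: field_simps)
    then show ?thesis unfolding e mirror_def right_diff_distrib by linarith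
  qed
  have "1 / (p - 1) < p"
  proof -
    have "1 < p * (p - 1)" using b(5) by (simp add: power2_eq_square algebra_simps)
    then show ?thesis using b(1) by (simp add: pos_divide_less_eq)
  qed
  then have "p * (p * x - 1) < 1" unfolding m mirror_def by linarith
  then show "p * x - 1 < 1 / p" using b(3) by (simp only: pos_less_divide_eq mult.commute)
qed

text \<open>
If the point at \<open>p\<close> is an endpoint of the switch region, then for nearby bases it may just miss the
region. Two steps later the orbit is then close to \<open>p - 1\<close> or to its mirror image, which are interior points.
\<close>

lemma enters_near_switch:
  assumes p: "inner_base p" and u: "isCont u p" "u p \<in> switch p"
  shows "\<exists>W. finite W \<and> (\<forall>\<^sub>F q in nhds p. thin q (u q) \<longrightarrow> enters q (u q) W)"
proof -
  note b = inner_baseD[OF p] and g = golden_orbit_of_one[OF p]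
  note ends = isCont_switch_ends[OF b(1)]
  consider "1 / p < u p" "u p < 1 / (p * (p - 1))" | "u p = 1 / p" | "u p = 1 / (p * (p - 1))"
    using u(2) by (force simp: switch_def)
  then show ?thesis
  proof cases
    case 1
    then have "\<forall>\<^sub>F q in nhds p. forced q (u q) []" using eventually_forced[OF b(1) u(1), of "[]"] by simp
    then have "\<forall>\<^sub>F q in nhds p. thin q (u q) \<longrightarrow> enters q (u q) {[]}"
      using eventually_inner_base[OF p]
    proof eventually_elim
      case (elim q)
      then show ?case using forced_enters[of q "u q" "[]" "{[]}"] inner_baseD(1,2)[of q] by blast
    qed
    then show ?thesis by (intro exI[of _ "{[]}"] conjI finite.intros)
  next
    case 2
    have c: "isCont (\<lambda>q. q * u q) p" using u(1) by (intro continuous_intros)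
    have "forced p (p * u p) [1]" using g b by (simp add: 2)
    then have "\<forall>\<^sub>F q in nhds p. forced q (q * u q) [1]" by (rule eventually_forced[OF b(1) c])
    moreover have "\<forall>\<^sub>F q in nhds p. u q < 1 / (q * (q - 1))"
      using less_trans[OF g(1,2)] by (intro eventually_nhds_less u(1) ends(2)) (simp only: 2)
    ultimately have "\<forall>\<^sub>F q in nhds p. thin q (u q) \<longrightarrow> enters q (u q) {[], [0, 1]}"
      using eventually_inner_base[OF p]
    proof eventually_elim
      case (elim q)
      show ?case
      proof
        assume t: "thin q (u q)"
        show "enters q (u q) {[], [0, 1]}"
        proof (cases "u q < 1 / q")
          case True
          then have "forced q (u q) [0, 1]" using elim by simp
          then show ?thesis using forced_enters[OF inner_baseD(1,2)[OF elim(3)] _ t] by blast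
        next
          case False
          then have "u q \<in> switch q" using elim(2) unfolding switch_def atLeastAtMost_iff by linarith
          then show ?thesis using enters_in_switch[OF t] by blast
        qed
      qed
    qed
    then show ?thesis by (intro exI[of _ "{[], [0, 1]}"] conjI finite.intros)
  next
    case 3
    have c: "isCont (\<lambda>q. q * u q - 1) p" using u(1) by (intro continuous_intros)
    have "1 / p < mirror p (p - 1)" "mirror p (p - 1) < 1 / (p * (p - 1))"
      by (rule mirror_of_one_less[OF p])+
    then have "forced p (p * u p - 1) [0]" using upper_end_orbit[OF p 3] by simp
    then have "\<forall>\<^sub>F q in nhds p. forced q (q * u q - 1) [0]" by (rule eventually_forced[OF b(1) c])
    moreover have "\<forall>\<^sub>F q in nhds p. 1 / q < u q"
      using 3 g b by (intro eventually_nhds_less u(1) ends(1)) simp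
    ultimately have "\<forall>\<^sub>F q in nhds p. thin q (u q) \<longrightarrow> enters q (u q) {[], [1, 0]}"
      using eventually_inner_base[OF p]
    proof eventually_elim
      case (elim q)
      show ?case
      proof
        assume t: "thin q (u q)"
        show "enters q (u q) {[], [1, 0]}"
        proof (cases "1 / (q * (q - 1)) < u q")
          case True
          then have "forced q (u q) [1, 0]" using elim by simp
          then show ?thesis using forced_enters[OF inner_baseD(1,2)[OF elim(3)] _ t] by blast
        next
          case False
          then have "u q \<in> switch q" using elim(2) unfolding switch_def atLeastAtMost_iff by linarith
          then show ?thesis using enters_in_switch[OF t] by blast
        qed
      qed
    qed
    then show ?thesis by (intro exI[of _ "{[], [1, 0]}"] conjI finite.intros)
  qed
qed

lemma enters_Cons:
  "enters q (q * x - real d) W \<Longrightarrow> enters q x ((#) d ` W)"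
  unfolding enters_def by force

lemma enters_near_run:
  assumes p: "inner_base p" and u: "isCont u p" "run p (u p) ds \<in> switch p" and ds: "set ds \<subseteq> {0, 1}"
  shows "\<exists>W. finite W \<and> (\<forall>\<^sub>F q in nhds p. thin q (u q) \<longrightarrow> enters q (u q) W)"
  using u ds
proof (induction ds arbitrary: u)
  case Nil
  then show ?case using enters_near_switch[OF p] by simp
next
  case (Cons d ds)
  note b = inner_baseD[OF p]
  note ends = isCont_switch_ends[OF b(1)]
  have c: "isCont (\<lambda>q. q * u q - real d) p" using Cons.prems by (intro continuous_intros)
  obtain W where W: "finite W"
    "\<forall>\<^sub>F q in nhds p. thin q (q * u q - real d) \<longrightarrow> enters q (q * u q - real d) W"
    using Cons.IH[OF c] Cons.prems by auto
  have I: "p * u p - real d \<in> attractor p"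
    using run_back[OF b(1), of "p * u p - real d" ds] Cons.prems switch_children(3)[OF b(1)] by simp
  have fin: "finite ((#) d ` W)" using W(1) by simp
  consider "u p \<in> switch p" | "u p < 1 / p" | "1 / (p * (p - 1)) < u p" by (force simp: switch_def)
  then show ?case
  proof cases
    case 1
    then show ?thesis using enters_near_switch[OF p] Cons.prems by blast
  next
    case 2
    have "p * u p < 1" using 2 b by (simp add: less_divide_eq mult_ac)
    then have d: "d = 0" using I Cons.prems by (auto simp: attractor_def)
    have "\<forall>\<^sub>F q in nhds p. u q < 1 / q"
      by (rule eventually_nhds_less[OF Cons.prems(1) ends(1) 2])
    then have "\<forall>\<^sub>F q in nhds p. thin q (u q) \<longrightarrow> enters q (u q) ((#) d ` W)"
      using eventually_inner_base[OF p] W(2)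
    proof eventually_elim
      case (elim q)
      then show ?case using thin_low[of q "u q"] inner_baseD[of q] enters_Cons[of q "u q" d W] by (simp add: d)
    qed
    then show ?thesis by (intro exI[of _ "(#) d ` W"] conjI fin)
  next
    case 3
    have "1 / (p - 1) < p * u p" using 3 b by (simp add: field_simps)
    then have d: "d = 1" using I Cons.prems by (auto simp: attractor_def)
    have "\<forall>\<^sub>F q in nhds p. 1 / (q * (q - 1)) < u q"
      by (rule eventually_nhds_less[OF ends(2) Cons.prems(1) 3])
    then have "\<forall>\<^sub>F q in nhds p. thin q (u q) \<longrightarrow> enters q (u q) ((#) d ` W)"
      using eventually_inner_base[OF p] W(2)
    proof eventually_elim
      case (elim q)
      then show ?case using thin_high[of q "u q"] inner_baseD[of q] enters_Cons[of q "u q" d W] by (simp add: d)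
    qed
    then show ?thesis by (intro exI[of _ "(#) d ` W"] conjI fin)
  qed
qed

text \<open>
At \<open>p\<close> the orbit reaches the switch region after finitely many steps. Up to then nearby bases have the
same itinerary, and if the region is met at an endpoint they enter there or two steps later; so finitely
many itineraries suffice for all of them.
\<close>

lemma enters_near_branching:
  assumes p: "inner_base p" and u: "isCont u p" "\<not> univoque p (u p)"
  shows "\<exists>W. finite W \<and> (\<forall>\<^sub>F q in nhds p. thin q (u q) \<longrightarrow> enters q (u q) W)"
proof (cases "u p \<in> attractor p")
  case True
  then obtain y where "reaches p (u p) y" "y \<in> switch p" using u(2) unfolding univoque_def by blast
  then obtain ds where "set ds \<subseteq> {0, 1}" "run p (u p) ds \<in> switch p" unfolding reaches_def by blast
  then show ?thesis using enters_near_run[OF p u(1)] by blast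
next
  case False
  note b = inner_baseD[OF p]
  have c: "isCont (\<lambda>q :: real. 1 / (q - 1)) p" using b by (auto intro!: continuous_intros)
  have "\<forall>\<^sub>F q in nhds p. \<not> thin q (u q)"
  proof (cases "u p < 0")
    case True
    have "\<forall>\<^sub>F q in nhds p. u q < 0" using True u(1) by (intro eventually_nhds_less) auto
    then show ?thesis by eventually_elim (simp add: thin_def attractor_def)
  next
    case nonneg: False
    then have "1 / (p - 1) < u p" using False by (simp add: attractor_def)
    then have "\<forall>\<^sub>F q in nhds p. 1 / (q - 1) < u q" using c u(1) by (intro eventually_nhds_less) auto
    then show ?thesis by eventually_elim (simp add: thin_def attractor_def)
  qed
  then have "\<forall>\<^sub>F q in nhds p. thin q (u q) \<longrightarrow> enters q (u q) {}" by eventually_elim simp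
  then show ?thesis by (intro exI[of _ "{}"] conjI finite.intros)
qed

lemma degree_shifted_poly: "degree (monom 1 K * [:-1, 0, 1 :: real:]) = K + 2"
  by (subst degree_mult_eq) (auto simp: degree_monom_eq)

text \<open>
Every step raises the degree by one, starting from the degree \<open>K + 2\<close> of the common
denominator. This is what makes the polynomial equations below nontrivial.
\<close>

lemma run_tail_poly:
  assumes "k \<le> K"
  shows "\<exists>P :: real poly. K + 2 \<le> degree P \<and>
    (\<forall>q>1. poly P q = run q (1 + alt_tail q k) w * (q ^ K * (q\<^sup>2 - 1)))"
proof (induction w rule: rev_induct)
  case Nil
  define D where "D = monom 1 K * [:-1, 0, 1 :: real:]"
  have D: "degree D = K + 2" unfolding D_def by (rule degree_shifted_poly)
  have pD: "poly D q = q ^ K * (q\<^sup>2 - 1)" for q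
    by (simp add: D_def poly_monom algebra_simps power2_eq_square)
  have "degree (D + monom 1 (K + 1 - k)) = K + 2"
    using D by (subst degree_add_eq_left) (simp_all add: degree_monom_eq)
  moreover have "poly (D + monom 1 (K + 1 - k)) q = (1 + alt_tail q k) * (q ^ K * (q\<^sup>2 - 1))" if "q > 1" for q
  proof -
    have "q ^ (K + 1 - k) = q ^ (K + 1) / q ^ k" using assms that by (intro power_diff) auto
    moreover have "q\<^sup>2 - 1 \<noteq> 0" using that by (simp add: power2_eq_1_iff)
    ultimately have "q ^ (K + 1 - k) = alt_tail q k * (q ^ K * (q\<^sup>2 - 1))" by (simp add: alt_tail_def)
    then show ?thesis by (simp add: pD poly_monom algebra_simps)
  qed
  ultimately show ?case by (intro exI[of _ "D + monom 1 (K + 1 - k)"]) simp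
next
  case (snoc d w)
  then obtain P :: "real poly" where P: "K + 2 \<le> degree P"
    "\<And>q. q > 1 \<Longrightarrow> poly P q = run q (1 + alt_tail q k) w * (q ^ K * (q\<^sup>2 - 1))" by blast
  define D where "D = monom 1 K * [:-1, 0, 1 :: real:]"
  have D: "degree D = K + 2" unfolding D_def by (rule degree_shifted_poly)
  have pD: "poly D q = q ^ K * (q\<^sup>2 - 1)" for q
    by (simp add: D_def poly_monom algebra_simps power2_eq_square)
  define R where "R = pCons 0 P - smult (real d) D"
  have "coeff D (Suc (degree P)) = 0" using P(1) D by (intro coeff_eq_0) simp
  then have "coeff R (Suc (degree P)) = lead_coeff P" by (simp add: R_def)
  moreover have "lead_coeff P \<noteq> 0" using P(1) by force
  ultimately have "K + 2 \<le> degree R" using le_degree[of R "Suc (degree P)"] P(1) by simp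
  moreover have "poly R q = run q (1 + alt_tail q k) (w @ [d]) * (q ^ K * (q\<^sup>2 - 1))" if "q > 1" for q
  proof -
    have "poly R q = q * poly P q - real d * (q ^ K * (q\<^sup>2 - 1))" by (simp add: R_def pD)
    also have "\<dots> = (q * run q (1 + alt_tail q k) w - real d) * (q ^ K * (q\<^sup>2 - 1))"
      unfolding P(2)[OF that] by (simp only: left_diff_distrib mult.assoc)
    finally show ?thesis by (simp add: run_append)
  qed
  ultimately show ?case by blast
qed

text \<open>
After multiplication by the common denominator the orbit point has degree at least \<open>K + 2\<close>, the branching point and its mirror
image only at most \<open>K + 1\<close>, so the equations are not identities in \<open>q\<close>.
\<close>

lemma finite_coincidences:
  "finite {q. 1 < q \<and> (run q (1 + alt_tail q k) w = (1 + alt_tail q j) / q \<or>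
     mirror q (run q (1 + alt_tail q k) w) = (1 + alt_tail q j) / q)}"
proof -
  define K where "K = k + j + 1"
  obtain P :: "real poly" where P: "K + 2 \<le> degree P"
    "\<And>q. q > 1 \<Longrightarrow> poly P q = run q (1 + alt_tail q k) w * (q ^ K * (q\<^sup>2 - 1))"
    using run_tail_poly[of k K w] by (auto simp: K_def)
  define Z where "Z = monom 1 (K - 1) * [:-1, 0, 1 :: real:] + monom 1 (K - j)"
  define M where "M = monom 1 K * [:1, 1 :: real:]"
  have dZ: "degree Z \<le> K + 1" unfolding Z_def
    by (rule degree_add_le, unfold degree_shifted_poly) (auto simp: degree_monom_eq K_def)
  have dM: "degree M \<le> K + 1" unfolding M_def by (subst degree_mult_eq) (auto simp: degree_monom_eq)
  have pZ: "poly Z q = (1 + alt_tail q j) / q * (q ^ K * (q\<^sup>2 - 1))" if "q > 1" for q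
  proof -
    have "q ^ (K - 1) = q ^ K / q ^ 1" "q ^ (K - j) = q ^ K / q ^ j"
      using that by (intro power_diff; simp add: K_def)+
    moreover have "q\<^sup>2 - 1 \<noteq> 0" using that by (simp add: power2_eq_1_iff)
    moreover have "poly Z q = q ^ (K - 1) * (q\<^sup>2 - 1) + q ^ (K - j)"
      by (simp add: Z_def poly_monom algebra_simps power2_eq_square)
    ultimately show ?thesis using that by (simp add: alt_tail_def distrib_right add_divide_distrib)
  qed
  have pM: "poly M q = 1 / (q - 1) * (q ^ K * (q\<^sup>2 - 1))" if "q > 1" for q
  proof -
    have "q\<^sup>2 - 1 = (q - 1) * (q + 1)" by (simp add: power2_eq_square algebra_simps)
    then have "1 / (q - 1) * (q ^ K * (q\<^sup>2 - 1)) = q ^ K * (q + 1)" using that by simp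
    then show ?thesis by (simp add: M_def poly_monom algebra_simps)
  qed
  have ne: "P - Z \<noteq> 0" "M - P - Z \<noteq> 0"
  proof -
    show "P - Z \<noteq> 0" using P(1) dZ by auto
    have "degree (M - Z) \<le> K + 1" using dM dZ by (rule degree_diff_le)
    then have "M - Z \<noteq> P" using P(1) by auto
    then show "M - P - Z \<noteq> 0" by (auto simp: algebra_simps)
  qed
  have "{q. 1 < q \<and> (run q (1 + alt_tail q k) w = (1 + alt_tail q j) / q \<or>
      mirror q (run q (1 + alt_tail q k) w) = (1 + alt_tail q j) / q)}
    \<subseteq> {q. poly (P - Z) q = 0} \<union> {q. poly (M - P - Z) q = 0}"
  proof (rule subsetI, unfold mem_Collect_eq Un_iff, elim conjE)
    fix q assume q: "1 < q" and "run q (1 + alt_tail q k) w = (1 + alt_tail q j) / q \<or>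
      mirror q (run q (1 + alt_tail q k) w) = (1 + alt_tail q j) / q"
    then consider "run q (1 + alt_tail q k) w = (1 + alt_tail q j) / q"
      | "mirror q (run q (1 + alt_tail q k) w) = (1 + alt_tail q j) / q" by blast
    then show "poly (P - Z) q = 0 \<or> poly (M - P - Z) q = 0"
    proof cases
      case 1
      then have "poly (P - Z) q = 0" unfolding poly_diff P(2)[OF q] pZ[OF q] by simp
      then show ?thesis ..
    next
      case 2
      have "poly (M - P - Z) q =
          (mirror q (run q (1 + alt_tail q k) w) - (1 + alt_tail q j) / q) * (q ^ K * (q\<^sup>2 - 1))"
        unfolding poly_diff P(2)[OF q] pZ[OF q] pM[OF q] mirror_def by (simp only: left_diff_distrib)
      then show ?thesis unfolding 2 by simp
    qed
  qed
  then show ?thesis using poly_roots_finite[OF ne(1)] poly_roots_finite[OF ne(2)]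
    by (meson finite_UnI finite_subset)
qed

lemma eventually_at_not_in_finite:
  fixes p :: real
  assumes "finite F"
  shows "\<forall>\<^sub>F q in at p. q \<notin> F"
proof -
  have "open (- (F - {p}))" using assms by (intro open_Compl finite_imp_closed) simp
  then show ?thesis unfolding eventually_at_topological by (intro exI[of _ "- (F - {p})"]) auto
qed

lemma eventually_no_coincidence:
  fixes p :: real
  assumes "finite W"
  shows "\<forall>\<^sub>F q in at p. 1 < q \<longrightarrow> (\<forall>w\<in>W. \<forall>j<J. run q (1 + alt_tail q k) w \<noteq> (1 + alt_tail q j) / q \<and>
      mirror q (run q (1 + alt_tail q k) w) \<noteq> (1 + alt_tail q j) / q)"
proof -
  have "finite (\<Union>w\<in>W. \<Union>j<J. {q. 1 < q \<and> (run q (1 + alt_tail q k) w = (1 + alt_tail q j) / q \<or>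
     mirror q (run q (1 + alt_tail q k) w) = (1 + alt_tail q j) / q)})"
    using assms finite_coincidences by blast
  from eventually_at_not_in_finite[OF this, of p] show ?thesis
    by eventually_elim auto
qed

text \<open>
The bound is uniform in the base, because \<open>q > 8/5\<close>.
\<close>

lemma alt_tail_small:
  assumes "0 < \<delta>"
  obtains J where "\<And>q j. inner_base q \<Longrightarrow> J \<le> j \<Longrightarrow> alt_tail q j < \<delta>"
proof -
  obtain J where J: "(5 / 8) ^ J < \<delta>" using real_arch_pow_inv[OF assms, of "5 / 8"] by auto
  have "alt_tail q j < \<delta>" if q: "inner_base q" and j: "J \<le> j" for q j
  proof -
    note b = inner_baseD[OF q]
    have "alt_tail q j = alt_tail q 0 * (1 / q) ^ j" by (simp add: alt_tail_def power_one_over)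
    also have "\<dots> \<le> 1 * (1 / q) ^ j"
      using alt_tail_0_bounds(2)[OF q] b by (intro mult_right_mono) auto
    also have "(1 / q) ^ j \<le> (5 / 8) ^ j"
      using q b by (intro power_mono) (auto simp: inner_base_def divide_le_eq)
    also have "(5 / 8) ^ j \<le> (5 / 8 :: real) ^ J" using j by (intro power_decreasing) auto
    finally show ?thesis using J by simp
  qed
  then show thesis using that by blast
qed

lemma isCont_alt_tail: "1 < p \<Longrightarrow> isCont (\<lambda>q. alt_tail q k) p"
  unfolding alt_tail_def by (intro continuous_intros) (auto simp: power2_eq_1_iff)

text \<open>
Finitely many itineraries and finitely many tails above \<open>\<delta>\<close> give finitely many polynomial equations,
and the punctured neighbourhood can be chosen to avoid their roots.
\<close>

lemma next_tail_small:
  assumes p: "inner_base p" and k: "2 \<le> k" and \<delta>: "0 < \<delta>"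
  shows "\<forall>\<^sub>F q in at p. thin q (1 + alt_tail q k) \<longrightarrow> (\<exists>a\<in>tails q. a < \<delta> \<and> thin q (1 + a))"
proof -
  note b = inner_baseD[OF p]
  have "isCont (\<lambda>q. 1 + alt_tail q k) p" by (intro continuous_intros isCont_alt_tail b)
  moreover have "\<not> univoque p (1 + alt_tail p k)"
    using k by (intro one_plus_tail_not_univoque[OF p]) (simp add: tails_def)
  ultimately obtain W where W: "finite W"
    "\<forall>\<^sub>F q in nhds p. thin q (1 + alt_tail q k) \<longrightarrow> enters q (1 + alt_tail q k) W"
    using enters_near_branching[OF p, of "\<lambda>q. 1 + alt_tail q k"] by blast
  obtain J where J: "\<And>q j. inner_base q \<Longrightarrow> J \<le> j \<Longrightarrow> alt_tail q j < \<delta>" using alt_tail_small[OF \<delta>] by blast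
  show ?thesis
    using eventually_at_of_nhds[OF W(2)] eventually_at_of_nhds[OF eventually_inner_base[OF p]]
      eventually_no_coincidence[OF W(1), where p = p and J = J and k = k]
  proof eventually_elim
    case (elim q)
    note bq = inner_baseD[OF elim(2)]
    show ?case
    proof
      assume "thin q (1 + alt_tail q k)"
      then obtain w where w: "w \<in> W" "thin q (run q (1 + alt_tail q k) w)"
        "run q (1 + alt_tail q k) w \<in> switch q" using elim(1) unfolding enters_def by blast
      then obtain a where a: "a \<in> tails q" "thin q (1 + a)"
        "run q (1 + alt_tail q k) w = (1 + a) / q \<or> mirror q (run q (1 + alt_tail q k) w) = (1 + a) / q"
        using thin_switch[OF elim(2) w(2,3)] by blast
      have "a < \<delta>"
      proof (cases "a = 0")
        case False
        then obtain j where j: "a = alt_tail q j" using a(1) by (auto simp: tails_def)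
        have "\<not> j < J" using elim(3) bq(1) w(1) a(3) unfolding j by blast
        then show ?thesis using J elim(2) j by simp
      qed (use \<delta> in simp)
      then show "\<exists>a\<in>tails q. a < \<delta> \<and> thin q (1 + a)" using a by blast
    qed
  qed
qed

text \<open>
Since the orbit enters the interior of the switch region, the next tail is bounded below, and this leaves
finitely many polynomial equations; these have no roots \<open>q \<noteq> p\<close> near \<open>p\<close>.
\<close>

lemma forced_not_thin:
  assumes p: "inner_base p" and f: "forced p (1 + alt_tail p k) w"
  shows "\<forall>\<^sub>F q in at p. \<not> thin q (1 + alt_tail q k)"
proof -
  note b = inner_baseD[OF p]
  have cu: "isCont (\<lambda>q. 1 + alt_tail q k) p" by (intro continuous_intros isCont_alt_tail b)
  define v where "v q = run q (1 + alt_tail q k) w" for q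
  have cv: "isCont v p" unfolding v_def by (rule isCont_run[OF cu])
  have vp: "1 / p < v p" "v p < 1 / (p * (p - 1))" using forced_run[OF f] unfolding v_def by auto
  define \<eta> where "\<eta> = min (p * v p - 1) (1 / (p - 1) - p * v p) / 2"
  have lu: "1 < p * v p" "p * v p < 1 / (p - 1)"
  proof -
    show "1 < p * v p" using vp(1) b(3) by (simp only: pos_divide_less_eq mult.commute)
    have "p * v p < p * (1 / (p * (p - 1)))" using vp(2) b(3) by (rule mult_strict_left_mono)
    then show "p * v p < 1 / (p - 1)" using b(3) by simp
  qed
  have \<eta>: "0 < \<eta>" "\<eta> < p * v p - 1" "\<eta> < 1 / (p - 1) - p * v p"
    using lu by (auto simp: \<eta>_def min_def)
  have "\<forall>\<^sub>F q in nhds p. \<eta> < q * v q - 1" "\<forall>\<^sub>F q in nhds p. \<eta> < 1 / (q - 1) - q * v q"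
    using \<eta> b by (auto intro!: eventually_nhds_less continuous_intros cv)
  then have e: "\<forall>\<^sub>F q in at p. \<eta> < q * v q - 1" "\<forall>\<^sub>F q in at p. \<eta> < 1 / (q - 1) - q * v q"
    by (auto intro: eventually_at_of_nhds)
  obtain J where J: "\<And>q j. inner_base q \<Longrightarrow> J \<le> j \<Longrightarrow> alt_tail q j < \<eta>" using alt_tail_small[OF \<eta>(1)] by blast
  have "finite {w}" by simp
  note nc = eventually_no_coincidence[OF this, where p = p and J = J and k = k]
  show ?thesis
    using e eventually_at_of_nhds[OF eventually_inner_base[OF p]]
      eventually_at_of_nhds[OF eventually_forced[OF b(1) cu f]]
      nc
  proof eventually_elim
    case (elim q)
    note bq = inner_baseD[OF elim(3)]
    show ?case
    proof
      assume "thin q (1 + alt_tail q k)"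
      from forced_thin[OF bq(1,2) elim(4) this]
      have v: "thin q (v q)" "v q \<in> switch q" by (auto simp: v_def switch_def)
      obtain a where a: "a \<in> tails q" "v q = (1 + a) / q \<or> mirror q (v q) = (1 + a) / q"
        using thin_switch[OF elim(3) v] by blast
      have m: "q * mirror q (v q) = 1 + 1 / (q - 1) - q * v q" using bq by (simp add: mirror_def field_simps)
      have "1 + a = q * v q \<or> 1 + a = q * mirror q (v q)" using a(2) bq by auto
      then have "\<eta> < a" using elim(1,2) unfolding m by auto
      then obtain j where j: "a = alt_tail q j" using a(1) \<eta>(1) by (auto simp: tails_def)
      then have "j < J" using J[OF elim(3), of j] \<open>\<eta> < a\<close> by (meson leI less_asym)
      then show False using elim(5) bq(1) a(2) unfolding j v_def by blast
    qed
  qed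
qed

section \<open>Bases where the orbit of 1 meets a branching point\<close>

lemma mirror_low_iff:
  assumes "1 < q"
  shows "1 / (q * (q - 1)) < mirror q x \<longleftrightarrow> x < 1 / q" "mirror q x < 1 / q \<longleftrightarrow> 1 / (q * (q - 1)) < x"
    "1 / q < mirror q x \<longleftrightarrow> x < 1 / (q * (q - 1))" "mirror q x < 1 / (q * (q - 1)) \<longleftrightarrow> 1 / q < x"
proof -
  define X where "X = 1 / (q * (q - 1))"
  have "1 / (q - 1) = 1 / q + X" using assms by (simp add: X_def field_simps)
  then show "1 / (q * (q - 1)) < mirror q x \<longleftrightarrow> x < 1 / q" "mirror q x < 1 / q \<longleftrightarrow> 1 / (q * (q - 1)) < x"
    "1 / q < mirror q x \<longleftrightarrow> x < 1 / (q * (q - 1))" "mirror q x < 1 / (q * (q - 1)) \<longleftrightarrow> 1 / q < x"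
    unfolding mirror_def X_def[symmetric] by argo+
qed

lemma mirror_forced:
  assumes q: "1 < q" and f: "forced q x w"
  shows "forced q (mirror q x) (map (\<lambda>d. 1 - d) w)"
  using f
proof (induction w arbitrary: x)
  case Nil
  then show ?case by (simp add: mirror_low_iff[OF q])
next
  case (Cons d w)
  then have d: "d = 0 \<and> x < 1 / q \<or> d = 1 \<and> 1 / (q * (q - 1)) < x" by simp
  then have "mirror q (q * x - real d) = q * mirror q x - real (1 - d)"
    using mirror_step[OF q, of x "real d"] by auto
  then have "forced q (q * mirror q x - real (1 - d)) (map (\<lambda>d. 1 - d) w)"
    using Cons by (metis forced.simps(2))
  then show ?case using d by (auto simp: mirror_low_iff[OF q])
qed

lemma coincidence_polynomial_mono:
  fixes x y :: real
  assumes "1 < x" "x \<le> y" "0 \<le> x\<^sup>2 - x - 1"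
  shows "(x\<^sup>2 - x - 1) * ((x\<^sup>2 - 1) * x ^ m) \<le> (y\<^sup>2 - y - 1) * ((y\<^sup>2 - 1) * y ^ m)"
proof -
  have "x * (x - 1) \<le> y * (y - 1)" using assms by (intro mult_mono) auto
  then have 1: "x\<^sup>2 - x - 1 \<le> y\<^sup>2 - y - 1" by (simp add: power2_eq_square algebra_simps)
  have 2: "x\<^sup>2 \<le> y\<^sup>2" "x ^ m \<le> y ^ m" using assms by (auto intro: power_mono)
  have 3: "1 < x\<^sup>2" using assms(1) by simp
  have 4: "(x\<^sup>2 - 1) * x ^ m \<le> (y\<^sup>2 - 1) * y ^ m" using 2 3 assms by (intro mult_mono) auto
  show ?thesis
  proof (rule mult_mono[OF 1 4])
    show "0 \<le> y\<^sup>2 - y - 1" using 1 assms(3) by linarith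
    show "0 \<le> (x\<^sup>2 - 1) * x ^ m" using 3 assms(1) by simp
  qed
qed

lemma mult_strict_bounds:
  fixes x y :: real
  assumes "0 < a" "a < x" "x < b" "0 < c" "c < y" "y < d"
  shows "a * c < x * y" "x * y < b * d"
  using assms by (auto intro!: mult_strict_mono)

text \<open>
With \<open>j = m + 1\<close> the hypothesis says \<open>(p\<^sup>2 - p - 1)(p\<^sup>2 - 1) p\<^sup>m = 1\<close>. The left side is increasing in \<open>p\<close>, so
the root can be located: near \<open>1.7387\<close> for \<open>m = 1\<close>, near \<open>1.6975\<close> for \<open>m = 2\<close>, and below \<open>1.672\<close> for \<open>m \<ge> 3\<close>.
The itineraries are \<open>1111\<close>, \<open>11\<close> and \<open>1\<close>.
\<close>

lemma forced_direct:
  assumes p: "inner_base p" and j: "2 \<le> j" and e: "alt_tail p j = p\<^sup>2 - p - 1"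
  obtains w where "forced p (1 + alt_tail p j) w"
proof -
  note b = inner_baseD[OF p]
  define t where "t = p\<^sup>2 - p - 1"
  have t: "0 < t" using b by (simp add: t_def)
  have P: "p * (p - 1) = 1 + t" by (simp add: t_def power2_eq_square algebra_simps)
  define U where "U = 1 / (p * (p - 1))"
  have U: "U = 1 / (1 + t)" unfolding U_def P ..
  define F where "F x m = (x\<^sup>2 - x - 1) * ((x\<^sup>2 - 1) * x ^ m)" for x :: real and m :: nat
  have mono: "x \<le> y \<Longrightarrow> 1 < x \<Longrightarrow> 0 \<le> x\<^sup>2 - x - 1 \<Longrightarrow> F x m \<le> F y m" for x y m
    unfolding F_def using coincidence_polynomial_mono by blast
  obtain m where m: "j = Suc m" using j by (cases j) auto
  have F1: "F p m = 1"
    unfolding F_def e[symmetric] alt_tail_def m using b by simp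
  have v1: "p * (1 + alt_tail p j) - 1 = p\<^sup>2 * (p - 1) - 1"
    unfolding e by (simp add: power2_eq_square algebra_simps)
  have first: "U < 1 + alt_tail p j"
    using golden_orbit_of_one(3)[OF p] t unfolding e t_def[symmetric] U_def[symmetric] by linarith
  have "j = 2 \<or> j = 3 \<or> 4 \<le> j" using j by linarith
  then consider "m = 1" | "m = 2" | "3 \<le> m" using m by linarith
  then show thesis
  proof cases
    case 1
    have l: "1738 / 1000 < p"
    proof (rule ccontr)
      assume "\<not> 1738 / 1000 < p"
      then have "F p m \<le> F (1738 / 1000) m" using b by (intro mono) auto
      also have "\<dots> < 1" unfolding F_def 1 by (simp add: power2_eq_square)
      finally show False using F1 by simp
    qed
    have u: "p < 1739 / 1000"
    proof (rule ccontr)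
      assume "\<not> p < 1739 / 1000"
      then have "F (1739 / 1000) m \<le> F p m" by (intro mono) (auto simp: power2_eq_square)
      moreover have "1 < F (1739 / 1000) m" unfolding F_def 1 by (simp add: power2_eq_square)
      ultimately show False using F1 by simp
    qed
    define v1 v2 v3 v4 where "v1 = p\<^sup>2 * (p - 1) - 1" and "v2 = p * v1 - 1" and "v3 = p * v2 - 1" and "v4 = p * v3 - 1"
    have p2: "302 / 100 < p\<^sup>2" "p\<^sup>2 < 303 / 100"
    proof -
      have "(1738 / 1000)\<^sup>2 < p\<^sup>2" "p\<^sup>2 < (1739 / 1000)\<^sup>2" using l u by (auto intro!: power_strict_mono)
      then show "302 / 100 < p\<^sup>2" "p\<^sup>2 < 303 / 100" by (simp_all add: power2_eq_square)
    qed
    have "302 / 100 * (738 / 1000) < p\<^sup>2 * (p - 1)" using p2 l by (intro mult_strict_mono) auto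
    moreover have "p\<^sup>2 * (p - 1) < 3025 / 1000 * (739 / 1000)"
    proof -
      have "p\<^sup>2 < (1739 / 1000)\<^sup>2" using l u by (auto intro!: power_strict_mono)
      then have "p\<^sup>2 < 3025 / 1000" by (simp add: power2_eq_square)
      then show ?thesis using l u by (intro mult_strict_mono) auto
    qed
    ultimately have v1: "1228 / 1000 < v1" "v1 < 1236 / 1000" by (simp_all add: v1_def)
    have "1738 / 1000 * (1228 / 1000) < p * v1" "p * v1 < 1739 / 1000 * (1236 / 1000)"
      using mult_strict_bounds[OF _ l u _ v1] by auto
    then have v2: "1134 / 1000 < v2" "v2 < 1150 / 1000" by (simp_all add: v2_def)
    have "1738 / 1000 * (1134 / 1000) < p * v2" "p * v2 < 1739 / 1000 * (1150 / 1000)"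
      using mult_strict_bounds[OF _ l u _ v2] by auto
    then have v3: "970 / 1000 < v3" "v3 < 1 " by (simp_all add: v3_def)
    have "1738 / 1000 * (970 / 1000) < p * v3" "p * v3 < 1739 / 1000 * 1"
      using mult_strict_bounds[OF _ l u _ v3] by auto
    then have v4: "68 / 100 < v4" "v4 < 74 / 100" by (simp_all add: v4_def)
    have tb: "281 / 1000 < t" "t < 292 / 1000" using p2 l u by (auto simp: t_def)
    have Ub: "77 / 100 < U" "U < 8 / 10" unfolding U using tb by (auto simp: less_divide_eq divide_less_eq)
    have "1 / p < 68 / 100" using l by (simp add: divide_less_eq)
    then have "forced p (1 + alt_tail p j) [1, 1, 1, 1]"
      using first v1 v2 v3 v4 Ub unfolding forced.simps U_def[symmetric]
      by (simp add: \<open>p * (1 + alt_tail p j) - 1 = p\<^sup>2 * (p - 1) - 1\<close> v1_def[symmetric] v2_def[symmetric] v3_def[symmetric] v4_def[symmetric])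
    then show thesis by (rule that)
  next
    case 2
    have l: "169 / 100 < p"
    proof (rule ccontr)
      assume "\<not> 169 / 100 < p"
      then have "F p m \<le> F (169 / 100) m" using b by (intro mono) auto
      also have "\<dots> < 1" unfolding F_def 2 by (simp add: power2_eq_square)
      finally show False using F1 by simp
    qed
    have u: "p < 17 / 10"
    proof (rule ccontr)
      assume "\<not> p < 17 / 10"
      then have "F (17 / 10) m \<le> F p m" by (intro mono) (auto simp: power2_eq_square)
      moreover have "1 < F (17 / 10) m" unfolding F_def 2 by (simp add: power2_eq_square)
      ultimately show False using F1 by simp
    qed
    define v1 v2 where "v1 = p\<^sup>2 * (p - 1) - 1" and "v2 = p * v1 - 1"
    have "(169 / 100)\<^sup>2 < p\<^sup>2" "p\<^sup>2 < (17 / 10)\<^sup>2" using l u by (auto intro!: power_strict_mono)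
    then have p2: "2856 / 1000 < p\<^sup>2" "p\<^sup>2 < 289 / 100" by (simp_all add: power2_eq_square)
    have "2856 / 1000 * (69 / 100) < p\<^sup>2 * (p - 1)" "p\<^sup>2 * (p - 1) < 289 / 100 * (7 / 10)"
      using mult_strict_bounds[OF _ p2, of "69 / 100" "p - 1" "7 / 10"] l u by auto
    then have v1: "97 / 100 < v1" "v1 < 103 / 100" by (simp_all add: v1_def)
    have "169 / 100 * (97 / 100) < p * v1" "p * v1 < 17 / 10 * (103 / 100)"
      using mult_strict_bounds[OF _ l u _ v1] by auto
    then have v2: "63 / 100 < v2" "v2 < 76 / 100" by (simp_all add: v2_def)
    have tb: "156 / 1000 < t" "t < 200 / 1000" using p2 l u by (auto simp: t_def)
    have Ub: "83 / 100 < U" "U < 9 / 10" unfolding U using tb by (auto simp: less_divide_eq divide_less_eq)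
    have "1 / p < 6 / 10" using l by (simp add: divide_less_eq)
    then have "forced p (1 + alt_tail p j) [1, 1]"
      using first v1 v2 Ub unfolding forced.simps U_def[symmetric]
      by (simp add: \<open>p * (1 + alt_tail p j) - 1 = p\<^sup>2 * (p - 1) - 1\<close> v1_def[symmetric] v2_def[symmetric])
    then show thesis by (rule that)
  next
    case 3
    have u: "p < 1672 / 1000"
    proof (rule ccontr)
      assume "\<not> p < 1672 / 1000"
      then have "F (1672 / 1000) 3 \<le> F p 3" by (intro mono) (auto simp: power2_eq_square)
      also have "F p 3 \<le> F p m"
        unfolding F_def using b 3 by (intro mult_left_mono power_increasing) auto
      finally show False using F1 unfolding F_def by (simp add: power2_eq_square power3_eq_cube)
    qed
    have "p\<^sup>2 < (1672 / 1000)\<^sup>2" using b u by (auto intro!: power_strict_mono)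
    then have p2: "p\<^sup>2 < 2796 / 1000" by (simp add: power2_eq_square)
    have "p\<^sup>2 * (p - 1) < 2796 / 1000 * (672 / 1000)" using p2 u b by (intro mult_strict_mono) auto
    then have v: "p\<^sup>2 * (p - 1) - 1 < 88 / 100" by simp
    have "1672 / 1000 * (672 / 1000) > p * (p - 1)" using u b by (intro mult_strict_mono) auto
    then have "t < 124 / 1000" using P by simp
    then have Ub: "88 / 100 < U" unfolding U using t by (simp add: less_divide_eq)
    have "1 < (p\<^sup>2 * (p - 1) - 1) * p"
    proof -
      have "(p\<^sup>2 * (p - 1) - 1) * p - 1 = (p\<^sup>2 - p - 1) * (p\<^sup>2 + 1)"
        by (simp add: power2_eq_square algebra_simps)
      moreover have "0 < (p\<^sup>2 - p - 1) * (p\<^sup>2 + 1)" using b by (intro mult_pos_pos) auto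
      ultimately show ?thesis by linarith
    qed
    then have "1 / p < p\<^sup>2 * (p - 1) - 1" using b by (simp only: pos_divide_less_eq)
    then have "forced p (1 + alt_tail p j) [1]"
      using first v Ub unfolding forced.simps U_def[symmetric]
      by (simp add: \<open>p * (1 + alt_tail p j) - 1 = p\<^sup>2 * (p - 1) - 1\<close>)
    then show thesis by (rule that)
  qed
qed

text \<open>
With \<open>t = p\<^sup>2 - p - 1\<close>, \<open>m = j - 1\<close> and \<open>h = p\<^sup>-\<^sup>m\<close> the hypothesis becomes \<open>p\<^sup>2 t = 1 - h\<close>, and \<open>t\<close> is the mirror
image of the given point. The orbit of \<open>t\<close> is then explicit: it starts with \<open>t\<close>, \<open>p t = (1 - h)/p\<close>, \<open>1 - h\<close>. The
itineraries of \<open>t\<close> are \<open>000\<close>, \<open>00\<close>, \<open>0010\<close> and \<open>00101\<close> for \<open>m = 1, 2, 3, 4\<close>, and \<open>001\<close> for \<open>m \<ge> 5\<close>; mirroring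
exchanges the digits.
\<close>

lemma forced_mirrored:
  assumes p: "inner_base p" and j: "2 \<le> j" and e: "alt_tail p j = 1 / (p - 1) - 1 - (p\<^sup>2 - p - 1)"
  shows "\<exists>w. forced p (1 + alt_tail p j) w"
proof -
  note b = inner_baseD[OF p] and g = golden_orbit_of_one[OF p]
  define t where "t = p\<^sup>2 - p - 1"
  define x where "x = 1 / p"
  define U where "U = 1 / (p * (p - 1))"
  have t: "0 < t" using b by (simp add: t_def)
  have P: "p * (p - 1) = 1 + t" by (simp add: t_def power2_eq_square algebra_simps)
  have U: "U = 1 / (1 + t)" unfolding U_def P ..
  have x: "p * x = 1" "0 < x" "x < 1" using b by (auto simp: x_def)
  have x2: "1 < 2 * x" using b x(1) by (simp add: x_def)
  obtain m where m: "j = Suc m" "1 \<le> m" using j by (cases j) auto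
  define h where "h = x ^ m"
  have h: "0 < h" "h < 1" using x m by (auto simp: h_def power_less_one_iff)
  have h_eq: "p\<^sup>2 * t = 1 - h"
  proof -
    define s where "s = 1 / (p\<^sup>2 - 1)"
    have s: "s * (p\<^sup>2 - 1) = 1" using b by (simp add: s_def)
    have "alt_tail p j = s * h" using b by (simp add: alt_tail_def s_def h_def x_def m(1) power_one_over)
    moreover have "1 / (p - 1) = s * (p + 1)" using b by (simp add: s_def field_simps power2_eq_square)
    ultimately have "s * h = s * (p + 1) - 1 - t" using e by (simp add: t_def)
    then show ?thesis using s unfolding t_def by algebra
  qed
  have t_eq: "t = (1 - h) * x * x"
  proof -
    have "t = (p * x) * (p * x) * t" by (simp add: x)
    also have "\<dots> = p\<^sup>2 * t * x * x" by (simp add: power2_eq_square)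
    finally show ?thesis unfolding h_eq .
  qed
  have pt: "p * t = (1 - h) * x" unfolding t_eq using x(1) by algebra
  have ppt: "p * ((1 - h) * x) = 1 - h" using x(1) by algebra
  have l1: "(1 - h) * x < x" using h x by simp
  have l0: "t < x" unfolding t_eq using l1 x(3) h x(2)
    by (smt (verit) mult_less_cancel_left2 mult_pos_pos)
  have xp: "x < p - 1" "p - 1 < U" "U < 1" using g by (auto simp: x_def U_def)
  have conclude: ?thesis if "forced p t w" for w
  proof -
    have "mirror p t = 1 + alt_tail p j" unfolding e mirror_def t_def by simp
    then show ?thesis using mirror_forced[OF b(1) that] by (intro exI[of _ "map (\<lambda>d. 1 - d) w"]) simp
  qed
  \<comment> \<open>equality holds at \<open>q\<^sub>f\<close>\<close>
  have p3: "p\<^sup>2 * (p - 1) - 1 < 1 / (p - 1)"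
  proof -
    have "(p\<^sup>2 * (p - 1) - 1) * (p - 1) = p * (p * (p - 1)\<^sup>2) - p + 1"
      by (simp add: power2_eq_square algebra_simps)
    moreover have "p * (p * (p - 1)\<^sup>2) < p * 1" using b(3,6) by (intro mult_strict_left_mono)
    ultimately have "(p\<^sup>2 * (p - 1) - 1) * (p - 1) < 1" by linarith
    then show ?thesis using b(1) by (simp only: pos_less_divide_eq diff_gt_0_iff_gt)
  qed
  have Ux: "1 / (p - 1) = x + U" 
  proof -
    have "1 / (p - 1) = 1 / p + 1 / (p * (p - 1))" using b(1) by (simp add: field_simps)
    then show ?thesis by (simp only: x_def U_def)
  qed
  have pU: "p * U = x + U" unfolding Ux[symmetric] using b(1) by (simp add: U_def)
  have "m = 1 \<or> m = 2 \<or> 3 \<le> m" using m(2) by linarith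
  moreover have ?thesis if "m = 1"
  proof -
    have hx: "h = x" by (simp add: h_def that)
    have 1: "p * (p * t) = 1 - x" unfolding pt ppt by (simp only: hx)
    have 2: "p * (p * (p * t)) = p - 1" unfolding 1 using x(1) by (simp add: right_diff_distrib)
    have "p * t < x" "p * (p * t) < x" "x < p * (p * (p * t))" "p * (p * (p * t)) < U"
      unfolding 2 unfolding 1 using l1 x2 xp pt by simp_all
    then have "forced p t [0, 0, 0]"
      using l0 unfolding forced.simps x_def[symmetric] U_def[symmetric] by simp
    then show ?thesis by (rule conclude)
  qed
  moreover have ?thesis if "m = 2"
  proof -
    have hx: "h = x * x" by (simp add: h_def that power2_eq_square)
    have "x < 1 - h"
    proof -
      have "x * x * (p\<^sup>2 - p - 1) = 1 - x - h" unfolding hx using x(1) by algebra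
      moreover have "0 < x * x * (p\<^sup>2 - p - 1)" using x b by simp
      ultimately show ?thesis by linarith
    qed
    moreover have "1 - h < U"
    proof -
      have "t = (1 - h) * h" unfolding t_eq hx by simp
      then have "t < h" using h by simp
      moreover have "(1 - h) * (1 + t) = 1 + t - h - h * t" by (simp add: algebra_simps)
      moreover have "0 < h * t" using h t by simp
      ultimately have "(1 - h) * (1 + t) < 1" by linarith
      then show ?thesis unfolding U using t by (simp add: pos_less_divide_eq)
    qed
    ultimately have "forced p t [0, 0]"
      unfolding forced.simps x_def[symmetric] U_def[symmetric]
      using l0 l1 by (simp add: pt ppt)
    then show ?thesis by (rule conclude)
  qed
  moreover have ?thesis if "3 \<le> m"
  proof -
    have hx: "h \<le> x ^ 3" unfolding h_def using x that by (intro power_decreasing) auto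
    \<comment> \<open>\<open>h = 1 - p\<^sup>2 t\<close> decreases in \<open>p\<close>, so small values of \<open>h\<close> force large values of \<open>p\<close>\<close>
    have bound: "1 - (c\<^sup>2 - c - 1) * c\<^sup>2 \<le> h" if c: "p \<le> c" for c
    proof -
      have "p * (p - 1) \<le> c * (c - 1)" using c b by (intro mult_mono) auto
      then have tc: "t \<le> c\<^sup>2 - c - 1" by (simp add: t_def power2_eq_square algebra_simps)
      have "p\<^sup>2 \<le> c\<^sup>2" using c b by (intro power_mono) auto
      then have "p\<^sup>2 * t \<le> c\<^sup>2 * (c\<^sup>2 - c - 1)" using tc t by (intro mult_mono) auto
      then show ?thesis unfolding h_eq by (simp add: mult.commute)
    qed
    have p17: "17 / 10 < p"
    proof (rule ccontr)
      assume "\<not> 17 / 10 < p"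
      then have "1 - ((17 / 10)\<^sup>2 - 17 / 10 - 1) * (17 / 10)\<^sup>2 \<le> h" by (intro bound) simp
      moreover have "x ^ 3 \<le> (5 / 8) ^ 3"
        using p x by (intro power_mono) (auto simp: x_def inner_base_def divide_le_eq)
      ultimately show False using hx by (simp add: power2_eq_square power3_eq_cube)
    qed
    have p2: "289 / 100 < p\<^sup>2" using power_strict_mono[OF p17, of 2] by (simp add: power2_eq_square)
    have cube: "2 < p\<^sup>2 * (p - 1)"
    proof -
      have "289 / 100 * (7 / 10) < p\<^sup>2 * (p - 1)" using p2 p17 by (intro mult_strict_mono) auto
      then show ?thesis by simp
    qed
    have xn: "p ^ n * x ^ n = 1" for n using x(1) by (simp add: power_mult_distrib[symmetric])
    have up: "U < 1 - h"
    proof -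
      have "h * p ^ 3 \<le> x ^ 3 * p ^ 3" using hx b by (intro mult_right_mono) auto
      then have "h * p ^ 3 \<le> 1" using xn[of 3] by (simp add: mult.commute)
      moreover have "p\<^sup>2 + 2 < p ^ 3" using cube by (simp add: power2_eq_square power3_eq_cube algebra_simps)
      then have "h * (p\<^sup>2 + 2) < h * p ^ 3" using h by simp
      ultimately have "h * (p\<^sup>2 + 2) < 1" by linarith
      moreover have "(1 - h) * (1 + t) * p\<^sup>2 = p\<^sup>2 + (1 - h) - h * (p\<^sup>2 + (1 - h))"
      proof -
        have "(1 - h) * (1 + t) * p\<^sup>2 = (1 - h) * (p\<^sup>2 + p\<^sup>2 * t)" by (simp add: algebra_simps)
        then show ?thesis unfolding h_eq by (simp add: algebra_simps)
      qed
      moreover have "h * (p\<^sup>2 + (1 - h)) = h * (p\<^sup>2 + 2) - h - h * h" by (simp add: algebra_simps)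
      moreover have "0 < h * h" using h by simp
      ultimately have "1 * p\<^sup>2 < (1 - h) * (1 + t) * p\<^sup>2" by linarith
      then have "1 < (1 - h) * (1 + t)" using b by (simp only: mult_less_cancel_right_pos)
      then show ?thesis unfolding U using t by (simp add: pos_divide_less_eq)
    qed
    define v where "v = p * (1 - h) - 1"
    have start: "forced p t (0 # 0 # 1 # w) \<longleftrightarrow> forced p v w" for w
      unfolding forced.simps x_def[symmetric] U_def[symmetric]
      using l0 l1 up by (simp add: pt ppt v_def)
    have "m = 3 \<or> m = 4 \<or> 5 \<le> m" using that by linarith
    moreover have ?thesis if "m = 3"
    proof -
      have "p * (p * h) = x" unfolding h_def that power3_eq_cube using x(1) by algebra
      then have pv: "p * v = p * (p - 1) - x" by (simp add: v_def algebra_simps)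
      have ppv: "p * (p * v) = p\<^sup>2 * (p - 1) - 1" unfolding pv using x(1) by (simp add: power2_eq_square algebra_simps)
      have "p * (p * v) < p * U" unfolding ppv pU using p3 Ux by simp
      then have hi: "p * v < U" using b by simp
      have "p * x < p * (p * v)" unfolding ppv x(1) using cube by simp
      then have lo: "x < p * v" using b by simp
      have "p * v < p * x" using hi xp x(1) by simp
      then have "v < x" using b by simp
      then have "forced p v [0]"
        using lo hi unfolding forced.simps x_def[symmetric] U_def[symmetric] by simp
      then have "forced p t [0, 0, 1, 0]" unfolding start .
      then show ?thesis by (rule conclude)
    qed
    moreover have ?thesis if "m = 4"
    proof -
      have h4: "p * (p * h) = x * x"
      proof -
        have "h = x * x * (x * x)" by (simp add: h_def that eval_nat_numeral)
        then show ?thesis using x(1) by algebra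
      qed
      then have pv: "p * v = 1 + t - x * x" unfolding P[symmetric] by (simp add: v_def algebra_simps)
      have ppv: "p * (p * v) = p\<^sup>2 * (p - 1) - x" unfolding pv P[symmetric] using x(1)
        by (simp add: power2_eq_square algebra_simps)
      have "p * v < p * x"
      proof -
        have "t < x * x" unfolding t_eq using h x by simp
        then show ?thesis unfolding pv x(1) by simp
      qed
      then have v: "v < x" using b by simp
      have t19: "19 / 100 < t"
      proof -
        have "17 / 10 * (7 / 10) < p * (p - 1)" using p17 by (intro mult_strict_mono) auto
        then show ?thesis unfolding P by simp
      qed
      have x17: "x < 10 / 17" using p17 by (simp add: x_def divide_less_eq)
      have xx: "x * x < 10 / 17 * (10 / 17)" using x17 x by (intro mult_strict_mono) auto
      have "U < 100 / 119" unfolding U using t19 by (simp add: divide_less_eq)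
      then have 1: "U < p * v" unfolding pv using t19 xx by simp
      have p173: "173 / 100 < p"
      proof (rule ccontr)
        assume "\<not> 173 / 100 < p"
        then have "1 - ((173 / 100)\<^sup>2 - 173 / 100 - 1) * (173 / 100)\<^sup>2 \<le> h" by (intro bound) simp
        then have "21 / 100 \<le> h" by (simp add: power2_eq_square)
        moreover have "x * x * (x * x) < 10 / 17 * (10 / 17) * (10 / 17 * (10 / 17))"
          using mult_strict_mono'[OF xx xx] x by simp
        moreover have "h = x * x * (x * x)" by (simp add: h_def that eval_nat_numeral)
        ultimately show False by simp
      qed
      have "p * x < p * (100 / 173)" using p173 x(1) by simp
      then have x173: "x < 100 / 173" using b by simp
      have "(173 / 100)\<^sup>2 < p\<^sup>2" using p173 by (intro power_strict_mono) auto
      then have "(173 / 100)\<^sup>2 * (73 / 100) < p\<^sup>2 * (p - 1)" using p173 by (intro mult_strict_mono) auto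
      then have 2: "x < p * (p * v) - 1" unfolding ppv using x173 by (simp add: power2_eq_square)
      have 3: "p * (p * v) - 1 < U" unfolding ppv using p3 Ux by simp
      have "forced p v [0, 1]"
        using v 1 2 3 unfolding forced.simps x_def[symmetric] U_def[symmetric] by simp
      then have "forced p t [0, 0, 1, 0, 1]" unfolding start .
      then show ?thesis by (rule conclude)
    qed
    moreover have ?thesis if "5 \<le> m"
    proof -
      have "h \<le> x ^ 5" unfolding h_def using x that by (intro power_decreasing) auto
      then have "h * p ^ 5 \<le> x ^ 5 * p ^ 5" using b by (intro mult_right_mono) auto
      then have h5: "h * p ^ 5 \<le> 1" using xn[of 5] by (simp add: mult.commute)
      have "1 * 1 < p ^ 3 * (p * (p - 1))" unfolding P using b t by (intro mult_strict_mono) auto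
      moreover have "p ^ 3 * (p * (p - 1)) = p ^ 5 - p ^ 4" by (simp add: eval_nat_numeral algebra_simps)
      ultimately have "p ^ 4 + 1 < p ^ 5" by simp
      then have "h * (p ^ 4 + 1) < h * p ^ 5" using h by simp
      then have "h * (p ^ 4 + 1) < 1" using h5 by linarith
      then have "p\<^sup>2 * (p\<^sup>2 * h) < p\<^sup>2 * t" unfolding h_eq by (simp add: eval_nat_numeral algebra_simps)
      then have "p\<^sup>2 * h < t" using b(3) by (simp only: mult_less_cancel_left_pos zero_less_power)
      moreover have "p * v = p\<^sup>2 - p - p\<^sup>2 * h" by (simp add: v_def power2_eq_square algebra_simps)
      ultimately have "p * x < p * v" unfolding x(1) by (simp add: t_def)
      then have "x < v" using b by simp
      moreover have "0 < p * h" using b h by simp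
      then have "v < U" unfolding v_def using xp by (simp add: algebra_simps)
      ultimately have "forced p v []" unfolding forced.simps x_def[symmetric] U_def[symmetric] by simp
      then have "forced p t [0, 0, 1]" unfolding start .
      then show ?thesis by (rule conclude)
    qed
    ultimately show ?thesis by blast
  qed
  ultimately show ?thesis by blast
qed

lemma tail_forced_at_coincidence:
  assumes "inner_base p" and "2 \<le> j"
    and "alt_tail p j = p\<^sup>2 - p - 1 \<or> alt_tail p j = 1 / (p - 1) - 1 - (p\<^sup>2 - p - 1)"
  obtains w where "forced p (1 + alt_tail p j) w"
  using assms forced_direct forced_mirrored by metis

section \<open>Isolation of the bases\<close>

text \<open>
If \<open>p - 1\<close> is not the branching point of the \<open>j\<close>-th tail or its mirror image, then small
tails cannot be followed by the \<open>j\<close>-th one, by continuity. If it is, the orbit at \<open>p\<close> enters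
the interior of the switch region and the \<open>j\<close>-th tail does not occur at all near \<open>p\<close>.
\<close>

lemma tail_after_small_not_thin:
  assumes p: "inner_base p" and j: "2 \<le> j"
  shows "\<exists>\<delta>>0. \<forall>\<^sub>F q in at p. \<forall>a. 0 \<le> a \<longrightarrow> a \<le> \<delta> \<longrightarrow>
    (alt_tail q j = q\<^sup>2 - q - 1 + q\<^sup>2 * a \<or> alt_tail q j = 1 / (q - 1) - 1 - (q\<^sup>2 - q - 1) - q\<^sup>2 * a) \<longrightarrow>
    \<not> thin q (1 + alt_tail q j)"
proof (cases "alt_tail p j = p\<^sup>2 - p - 1 \<or> alt_tail p j = 1 / (p - 1) - 1 - (p\<^sup>2 - p - 1)")
  case True
  then obtain w where "forced p (1 + alt_tail p j) w" using tail_forced_at_coincidence[OF p j] by blast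
  then have "\<forall>\<^sub>F q in at p. \<not> thin q (1 + alt_tail q j)" by (rule forced_not_thin[OF p])
  then have "\<forall>\<^sub>F q in at p. \<forall>a. 0 \<le> a \<longrightarrow> a \<le> 1 \<longrightarrow>
    (alt_tail q j = q\<^sup>2 - q - 1 + q\<^sup>2 * a \<or> alt_tail q j = 1 / (q - 1) - 1 - (q\<^sup>2 - q - 1) - q\<^sup>2 * a) \<longrightarrow>
    \<not> thin q (1 + alt_tail q j)" by eventually_elim simp
  then show ?thesis by (intro exI[of _ 1]) simp
next
  case False
  note b = inner_baseD[OF p]
  define f where "f q = \<bar>alt_tail q j - (q\<^sup>2 - q - 1)\<bar>" for q
  define g where "g q = \<bar>alt_tail q j - (1 / (q - 1) - 1 - (q\<^sup>2 - q - 1))\<bar>" for q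
  \<comment> \<open>the term \<open>q\<^sup>2 a\<close> will be at most \<open>4 \<delta>\<close>, which is at most half of either defect at \<open>p\<close>\<close>
  define \<delta> where "\<delta> = min (f p) (g p) / 8"
  have pos: "0 < f p" "0 < g p" using False by (auto simp: f_def g_def)
  then have \<delta>: "0 < \<delta>" "4 * \<delta> < f p" "4 * \<delta> < g p" by (auto simp: \<delta>_def min_def)
  have "isCont f p" "isCont g p" unfolding f_def g_def
    using b by (auto intro!: continuous_intros isCont_alt_tail)
  then have "\<forall>\<^sub>F q in nhds p. 4 * \<delta> < f q" "\<forall>\<^sub>F q in nhds p. 4 * \<delta> < g q"
    using \<delta> by (auto intro!: eventually_nhds_less)
  then have "\<forall>\<^sub>F q in nhds p. \<forall>a. 0 \<le> a \<longrightarrow> a \<le> \<delta> \<longrightarrow>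
    (alt_tail q j = q\<^sup>2 - q - 1 + q\<^sup>2 * a \<or> alt_tail q j = 1 / (q - 1) - 1 - (q\<^sup>2 - q - 1) - q\<^sup>2 * a) \<longrightarrow>
    \<not> thin q (1 + alt_tail q j)"
    using eventually_inner_base[OF p]
  proof eventually_elim
    case (elim q)
    note bq = inner_baseD[OF elim(3)]
    have "q\<^sup>2 * a \<le> 4 * \<delta> \<and> 0 \<le> q\<^sup>2 * a" if "0 \<le> a" "a \<le> \<delta>" for a
    proof -
      have "q * q \<le> 2 * 2" using bq by (intro mult_mono) auto
      then have "q\<^sup>2 \<le> 4" by (simp add: power2_eq_square)
      then have "q\<^sup>2 * a \<le> 4 * \<delta>" using that by (intro mult_mono) simp_all
      then show ?thesis using that(1) by simp
    qed
    then have "alt_tail q j \<noteq> q\<^sup>2 - q - 1 + q\<^sup>2 * a"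
      "alt_tail q j \<noteq> 1 / (q - 1) - 1 - (q\<^sup>2 - q - 1) - q\<^sup>2 * a" if "0 \<le> a" "a \<le> \<delta>" for a
      using elim(1,2) that unfolding f_def g_def by fastforce+
    then show ?case by blast
  qed
  then show ?thesis using \<delta>(1) eventually_at_of_nhds by blast
qed

text \<open>
The point \<open>q - 1 + q a\<close> stays away from both ends of the switch region, since
\<open>p - 1\<close> is an interior point; hence the tail that it determines is bounded below.
\<close>

lemma next_tail_after_small:
  assumes p: "inner_base p"
  shows "\<exists>\<delta>>0. \<exists>J. \<forall>\<^sub>F q in nhds p. \<forall>a\<in>tails q. a \<le> \<delta> \<longrightarrow> thin q (1 + a) \<longrightarrow>
    (\<exists>j. 2 \<le> j \<and> j < J \<and> thin q (1 + alt_tail q j) \<and>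
      (alt_tail q j = q\<^sup>2 - q - 1 + q\<^sup>2 * a \<or> alt_tail q j = 1 / (q - 1) - 1 - (q\<^sup>2 - q - 1) - q\<^sup>2 * a))"
proof -
  note b = inner_baseD[OF p] and g = golden_orbit_of_one[OF p]
  note ends = isCont_switch_ends[OF b(1)]
  define \<delta> where "\<delta> = (1 / (p * (p - 1)) - (p - 1)) / (2 * p)"
  have \<delta>: "0 < \<delta>" "p - 1 + p * \<delta> < 1 / (p * (p - 1))"
  proof -
    define X where "X = 1 / (p * (p - 1))"
    have X: "p - 1 < X" "\<delta> = (X - (p - 1)) / (2 * p)" using g(2) by (simp_all add: X_def \<delta>_def)
    then show "0 < \<delta>" using b by simp
    have "p * \<delta> = (X - (p - 1)) / 2" using b unfolding X(2) by simp
    then show "p - 1 + p * \<delta> < 1 / (p * (p - 1))" using X(1) unfolding X_def[symmetric] by argo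
  qed
  define B where "B q = 1 / (q - 1) - 1 - (q\<^sup>2 - q - 1) - q\<^sup>2 * \<delta>" for q
  have Bp: "0 < B p"
  proof -
    have "p * (p - 1 + p * \<delta>) < p * (1 / (p * (p - 1)))" using \<delta>(2) b by (intro mult_strict_left_mono) auto
    also have "\<dots> = 1 / (p - 1)" using b by simp
    finally show ?thesis by (simp add: B_def power2_eq_square algebra_simps)
  qed
  define \<eta> where "\<eta> = min (p\<^sup>2 - p - 1) (B p) / 2"
  have \<eta>: "0 < \<eta>" "\<eta> < p\<^sup>2 - p - 1" "\<eta> < B p" using Bp b(5) by (auto simp: \<eta>_def min_def)
  obtain J where J: "\<And>q j. inner_base q \<Longrightarrow> J \<le> j \<Longrightarrow> alt_tail q j < \<eta>" using alt_tail_small[OF \<eta>(1)] by blast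
  have "isCont B p" unfolding B_def using b by (auto intro!: continuous_intros)
  then have "\<forall>\<^sub>F q in nhds p. \<eta> < B q" using \<eta> by (intro eventually_nhds_less) auto
  moreover have "\<forall>\<^sub>F q in nhds p. \<eta> < q\<^sup>2 - q - 1"
    using \<eta> by (intro eventually_nhds_less continuous_intros) auto
  moreover have "\<forall>\<^sub>F q in nhds p. q - 1 + q * \<delta> < 1 / (q * (q - 1))"
    using \<delta> by (intro eventually_nhds_less continuous_intros ends(2)) auto
  ultimately have "\<forall>\<^sub>F q in nhds p. \<forall>a\<in>tails q. a \<le> \<delta> \<longrightarrow> thin q (1 + a) \<longrightarrow>
    (\<exists>j. 2 \<le> j \<and> j < J \<and> thin q (1 + alt_tail q j) \<and>
      (alt_tail q j = q\<^sup>2 - q - 1 + q\<^sup>2 * a \<or> alt_tail q j = 1 / (q - 1) - 1 - (q\<^sup>2 - q - 1) - q\<^sup>2 * a))"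
    using eventually_inner_base[OF p]
  proof eventually_elim
    case (elim q)
    note bq = inner_baseD[OF elim(4)]
    show ?case
    proof (intro ballI impI)
      fix a assume a: "a \<in> tails q" "a \<le> \<delta>" and th: "thin q (1 + a)"
      have a0: "0 \<le> a" using tails_nonneg[OF bq(1) a(1)] .
      have "q * a \<le> q * \<delta>" "q\<^sup>2 * a \<le> q\<^sup>2 * \<delta>" "0 \<le> q\<^sup>2 * a" using a(2) a0 bq by (auto intro: mult_left_mono)
      then have w: "q - 1 + q * a \<le> 1 / (q * (q - 1))" using elim(3) by linarith
      obtain a' where a': "a' \<in> tails q" "thin q (1 + a')"
        "a' = q\<^sup>2 - q - 1 + q\<^sup>2 * a \<or> a' = 1 / (q - 1) - 1 - (q\<^sup>2 - q - 1) - q\<^sup>2 * a"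
        using next_tail[OF elim(4) th a0 w] .
      have "\<eta> < a'"
        using a'(3) elim(1,2) \<open>q\<^sup>2 * a \<le> q\<^sup>2 * \<delta>\<close> \<open>0 \<le> q\<^sup>2 * a\<close> unfolding B_def by (elim disjE) linarith+
      then obtain j where j: "2 \<le> j" "a' = alt_tail q j" using a'(1) \<eta>(1) by (auto simp: tails_def)
      have "j < J"
      proof (rule ccontr)
        assume "\<not> j < J"
        then have "alt_tail q j < \<eta>" using J[OF elim(4), of j] by simp
        then show False using \<open>\<eta> < a'\<close> j(2) by simp
      qed
      then show "\<exists>j. 2 \<le> j \<and> j < J \<and> thin q (1 + alt_tail q j) \<and>
        (alt_tail q j = q\<^sup>2 - q - 1 + q\<^sup>2 * a \<or> alt_tail q j = 1 / (q - 1) - 1 - (q\<^sup>2 - q - 1) - q\<^sup>2 * a)"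
        using a'(2,3) j(1) unfolding j(2) by (intro exI[of _ j] conjI)
    qed
  qed
  then show ?thesis using \<delta>(1) by blast
qed

text \<open>
Small tails do not occur: their successors are among finitely many tails, none of which can follow a
small one. Every other tail is followed by a small tail, so it does not occur either.
\<close>

lemma no_thin_near_inner_base:
  assumes p: "inner_base p"
  shows "\<forall>\<^sub>F q in at p. \<forall>x. \<not> thin q x"
proof -
  obtain \<delta>\<^sub>1 J where \<delta>\<^sub>1: "\<delta>\<^sub>1 > 0" and c: "\<forall>\<^sub>F q in nhds p. \<forall>a\<in>tails q. a \<le> \<delta>\<^sub>1 \<longrightarrow> thin q (1 + a) \<longrightarrow>
    (\<exists>j. 2 \<le> j \<and> j < J \<and> thin q (1 + alt_tail q j) \<and>
      (alt_tail q j = q\<^sup>2 - q - 1 + q\<^sup>2 * a \<or> alt_tail q j = 1 / (q - 1) - 1 - (q\<^sup>2 - q - 1) - q\<^sup>2 * a))"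
    using next_tail_after_small[OF p] by blast
  define R where "R \<delta> j q \<longleftrightarrow> (\<forall>a. 0 \<le> a \<longrightarrow> a \<le> \<delta> \<longrightarrow>
    (alt_tail q j = q\<^sup>2 - q - 1 + q\<^sup>2 * a \<or> alt_tail q j = 1 / (q - 1) - 1 - (q\<^sup>2 - q - 1) - q\<^sup>2 * a) \<longrightarrow>
    \<not> thin q (1 + alt_tail q j))" for \<delta> j q
  have "\<forall>j. \<exists>\<delta>>0. 2 \<le> j \<longrightarrow> (\<forall>\<^sub>F q in at p. R \<delta> j q)"
  proof (intro allI)
    fix j
    show "\<exists>\<delta>>0. 2 \<le> j \<longrightarrow> (\<forall>\<^sub>F q in at p. R \<delta> j q)"
    proof (cases "2 \<le> j")
      case True
      then show ?thesis using tail_after_small_not_thin[OF p True] unfolding R_def by blast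
    qed (auto intro: exI[of _ 1])
  qed
  then obtain D where D: "\<And>j. D j > 0" "\<And>j. 2 \<le> j \<Longrightarrow> \<forall>\<^sub>F q in at p. R (D j) j q" by metis
  define \<delta> where "\<delta> = Min (insert \<delta>\<^sub>1 (D ` {..<J}))"
  have \<delta>: "0 < \<delta>" "\<delta> \<le> \<delta>\<^sub>1" "\<And>j. j < J \<Longrightarrow> \<delta> \<le> D j"
    using \<delta>\<^sub>1 D(1) by (auto simp: \<delta>_def)
  obtain K where K: "\<And>q j. inner_base q \<Longrightarrow> K \<le> j \<Longrightarrow> alt_tail q j < \<delta>" using alt_tail_small[OF \<delta>(1)] by blast
  have d: "\<forall>\<^sub>F q in at p. \<forall>j\<in>{2..<J}. R (D j) j q"
    using D(2) by (intro eventually_ball_finite) auto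
  have s: "\<forall>\<^sub>F q in at p. \<forall>k\<in>{2..<K}. thin q (1 + alt_tail q k) \<longrightarrow> (\<exists>a\<in>tails q. a < \<delta> \<and> thin q (1 + a))"
    using next_tail_small[OF p _ \<delta>(1)] by (intro eventually_ball_finite) auto
  show ?thesis
    using eventually_at_of_nhds[OF c] d s eventually_at_of_nhds[OF eventually_inner_base[OF p]]
  proof eventually_elim
    case (elim q)
    note bq = inner_baseD[OF elim(4)]
    have small: "\<not> thin q (1 + a)" if a: "a \<in> tails q" "a \<le> \<delta>" for a
    proof
      assume "thin q (1 + a)"
      moreover have "a \<le> \<delta>\<^sub>1" using a(2) \<delta>(2) by linarith
      ultimately obtain j where j: "2 \<le> j" "j < J" "thin q (1 + alt_tail q j)"
        "alt_tail q j = q\<^sup>2 - q - 1 + q\<^sup>2 * a \<or> alt_tail q j = 1 / (q - 1) - 1 - (q\<^sup>2 - q - 1) - q\<^sup>2 * a"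
        using elim(1) a(1) by blast
      have "R (D j) j q" using elim(2) j by auto
      moreover have "a \<le> D j" using a(2) \<delta>(3)[OF j(2)] by linarith
      ultimately show False using j(3,4) tails_nonneg[OF bq(1) a(1)] unfolding R_def by blast
    qed
    show ?case
    proof (intro allI notI)
      fix x assume "thin q x"
      then obtain a where a: "a \<in> tails q" "thin q (1 + a)" using ex_thin_one_plus_tail[OF elim(4)] by blast
      then have "\<not> a \<le> \<delta>" using small by blast
      then obtain k where k: "2 \<le> k" "a = alt_tail q k" using a(1) \<delta>(1) by (auto simp: tails_def)
      have "k < K"
      proof (rule ccontr)
        assume "\<not> k < K"
        then have "alt_tail q k < \<delta>" using K[OF elim(4), of k] by simp
        then show False using \<open>\<not> a \<le> \<delta>\<close> k(2) by simp
      qed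
      then obtain a' where "a' \<in> tails q" "a' < \<delta>" "thin q (1 + a')"
        using elim(3) a(2) k by auto
      then show False using small[of a'] by simp
    qed
  qed
qed

lemma inner_base_between:
  assumes "(1 + sqrt 5) / 2 < q" "q < qf" "q \<noteq> q2"
  shows "inner_base q"
proof -
  have l: "8 / 5 < q"
  proof -
    have "(11 / 5)\<^sup>2 \<le> (5 :: real)" by (simp add: power2_eq_square)
    then have "11 / 5 \<le> sqrt 5" by (rule real_le_rsqrt)
    then show ?thesis using assms(1) by simp
  qed
  have u: "q < 44 / 25" using assms(2) qf_approx by simp
  have "sqrt 5 < 2 * q - 1" using assms(1) by simp
  then have "(sqrt 5)\<^sup>2 < (2 * q - 1)\<^sup>2" by (intro power_strict_mono) auto
  then have g: "q + 1 < q\<^sup>2" by (simp add: power2_eq_square algebra_simps)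
  have "q * (q - 1)\<^sup>2 < qf * (qf - 1)\<^sup>2"
    using assms(2) l by (intro mult_strict_mono power_strict_mono) auto
  also have "\<dots> = 1" using qf_root(2) by (simp add: power2_eq_square power3_eq_cube algebra_simps)
  finally have f: "q ^ 3 < 2 * q\<^sup>2 - q + 1" by (simp add: power2_eq_square power3_eq_cube algebra_simps)
  have "q ^ 4 \<noteq> 2 * q\<^sup>2 + q + 1"
    using q2_unique[of q q2] q2_root l u assms(3) by auto
  then show ?thesis using l u g f by (simp add: inner_base_def)
qed

lemma golden_square: "((1 + sqrt 5) / 2)\<^sup>2 - (1 + sqrt 5) / 2 - 1 = 0"
  by (simp add: power2_eq_square field_simps)

theorem theorem4p5:
  shows "discrete (B_aleph0 \<inter> ({(1 + sqrt 5) / 2..<qf} - {q2}))"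
proof (rule discreteI)
  define A where "A = B_aleph0 \<inter> ({(1 + sqrt 5) / 2..<qf} - {q2})"
  fix p assume "p \<in> B_aleph0 \<inter> ({(1 + sqrt 5) / 2..<qf} - {q2})"
  then have p: "p \<in> A" "(1 + sqrt 5) / 2 \<le> p" "p < qf" "p \<noteq> q2" by (simp_all add: A_def)
  have "\<forall>\<^sub>F q in at p. q \<notin> A"
  proof (cases "p = (1 + sqrt 5) / 2")
    case True
    have "\<forall>\<^sub>F q in nhds p. q\<^sup>2 - q - 1 < 1 / 1000"
      by (intro eventually_nhds_less continuous_intros) (simp add: True golden_square)
    then have near: "\<forall>\<^sub>F q in at p. q\<^sup>2 - q - 1 < 1 / 1000" by (rule eventually_at_of_nhds)
    have "\<forall>\<^sub>F q in at p. q \<noteq> p" by (simp add: eventually_at_filter)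
    with near show ?thesis
    proof eventually_elim
      case (elim q)
      show ?case
      proof
        assume q: "q \<in> A"
        then have "(1 + sqrt 5) / 2 < q" "q < qf" "q \<noteq> q2" using elim(2) True by (auto simp: A_def)
        then have "inner_base q" by (rule inner_base_between)
        moreover obtain x where "thin q x" using q B_aleph0_ex_thin by (auto simp: A_def)
        ultimately show False using no_thin_near_golden elim(1) by blast
      qed
    qed
  next
    case False
    then have "inner_base p" using p by (intro inner_base_between) auto
    then have "\<forall>\<^sub>F q in at p. \<forall>x. \<not> thin q x" by (rule no_thin_near_inner_base)
    then show ?thesis by eventually_elim (auto simp: A_def dest: B_aleph0_ex_thin)
  qed
  then obtain T where T: "open T" "p \<in> T" "\<And>q. q \<in> T \<Longrightarrow> q \<noteq> p \<Longrightarrow> q \<notin> A"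
    unfolding eventually_at_topological by blast
  then have "T \<inter> A = {p}" using p(1) by blast
  then have "p isolated_in A" unfolding isolated_in_def using p(1) T(1) by blast
  then show "p isolated_in (B_aleph0 \<inter> ({(1 + sqrt 5) / 2..<qf} - {q2}))" by (simp only: A_def)
qed

end
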